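(* Isotopy classes of (oriented) pseudo links in the thickened torus are in bijection with isotopy classes of (oriented) ${\rm H}$-mixed pseudo links in $S^3$, via isotopies that keep ${\rm H}$ point-wise fixed.
   Context: Notation: $\mathcal{T}=S^1\times S^1$ is the torus, $I=[0,1]$; $\mathcal{T}\times I$ is the thickened torus. A planar (resp. toroidal) pseudo link diagram is a regular knot or link diagram in the plane (resp. in the surface $\mathcal{T}$) in which, at some double points called precrossings, it is not known which strand passes over. The lift of a planar (resp. toroidal) pseudo link diagram in three-space or $S^3$ (resp. in $\mathcal{T}\times I$) is obtained by embedding every classical crossing in a sufficiently small 3-ball of the ambient space so that the over arc lies in its upper boundary and the under arc in its lower boundary, supporting each precrossing by a sufficiently small rigid disc embedded in the ambient space, and allowing the simple arcs connecting crossings to be replaced by isotopic ones. The result is a collection of closed curves in the interior of the ambient space consisting of embedded discs (precrossing discs) from which emanate embedded arcs; it is called a spatial pseudo link (resp. a pseudo link in the thickened torus). Two (oriented) pseudo links in the same ambient space are isotopic if they are related by isotopies of arcs and discs (within the interior of the thickened torus in that case). The thickened torus is viewed as homeomorphic to the complement in $S^3$ of the Hopf link ${\rm H}$, whose two components are marked, say by $m$ and $l$. An (oriented) ${\rm H}$-mixed pseudo link in $S^3$ is an (oriented) spatial pseudo link ${\rm H}\cup K$ which contains the marked Hopf link ${\rm H}$ as a point-wise fixed sublink, the sublink $K$ resulting by removing ${\rm H}$ being the moving part, such that there are no precrossing discs between the fixed and the moving part. A pseudo link $K$ in the thickened torus is represented by ${\rm H}\cup K$. *)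

theory Defs
  imports "HOL-Analysis.Analysis"
begin

text \<open>
  Tameness is imposed by working in the C^1 category.  The ambient spaces are submanifolds
  \<open>X\<close> of a Euclidean space, so that C^1 maps into \<open>X\<close> are C^1 maps into the Euclidean space
  with values in \<open>X\<close>.  Closed curves are 1-periodic maps on the reals, and discs are maps on
  the closed unit disc of the complex plane, with derivatives taken within that disc.
\<close>

definition regular_closed_curve :: "'a::euclidean_space set \<Rightarrow> (real \<Rightarrow> 'a) \<Rightarrow> bool" where
  "regular_closed_curve X \<gamma> \<longleftrightarrow>
     range \<gamma> \<subseteq> X \<and> (\<forall>s. \<gamma> (s + 1) = \<gamma> s) \<and>
     \<gamma> C1_differentiable_on UNIV \<and> (\<forall>s. vector_derivative \<gamma> (at s) \<noteq> 0)"

abbreviation disc_derivative :: "(complex \<Rightarrow> 'a::euclidean_space) \<Rightarrow> complex \<Rightarrow> complex \<Rightarrow> 'a" where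
  "disc_derivative \<delta> z \<equiv> frechet_derivative \<delta> (at z within cball 0 1)"

definition embedded_disc :: "'a::euclidean_space set \<Rightarrow> (complex \<Rightarrow> 'a) \<Rightarrow> bool" where
  "embedded_disc X \<delta> \<longleftrightarrow>
     \<delta> ` cball 0 1 \<subseteq> X \<and> inj_on \<delta> (cball 0 1) \<and> \<delta> differentiable_on cball 0 1 \<and>
     (\<forall>v. continuous_on (cball 0 1) (\<lambda>z. disc_derivative \<delta> z v)) \<and>
     (\<forall>z\<in>cball 0 1. inj (disc_derivative \<delta> z))"

text \<open>
  The two strands of a precrossing run along the two coordinate diameters of its disc, cross at
  the centre, and leave the disc as four arcs.  The curves meet the disc nowhere else.  The shift
  by an integer \<open>a\<close> accounts for the periodicity of the curves.
\<close>

definition precrossing_disc ::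
  "nat \<Rightarrow> (nat \<Rightarrow> real \<Rightarrow> 'a::euclidean_space) \<Rightarrow> (complex \<Rightarrow> 'a) \<Rightarrow> bool" where
  "precrossing_disc n \<gamma> \<delta> \<longleftrightarrow>
     (\<exists>i<n. \<exists>i'<n. \<exists>p q p' q'. p < q \<and> p' < q' \<and>
        \<gamma> i ` {p..q} = \<delta> ` closed_segment (-1) 1 \<and>
        \<gamma> i' ` {p'..q'} = \<delta> ` closed_segment (-\<i>) \<i> \<and>
        (\<forall>j<n. \<forall>s. \<gamma> j s \<in> \<delta> ` cball 0 1 \<longrightarrow>
           (\<exists>a\<in>\<int>. j = i \<and> s + a \<in> {p..q} \<or> j = i' \<and> s + a \<in> {p'..q'})))"

text \<open>
  A parametrized pseudo link in \<open>X\<close>, with closed curves \<open>\<gamma> i\<close> for \<open>i < n\<close> and precrossing discs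
  \<open>\<delta> j\<close> for \<open>j < k\<close>.  Apart from the crossings at the centres of the discs, the curves are
  simple and disjoint.
\<close>

definition parametrized_pseudo_link ::
  "'a::euclidean_space set \<Rightarrow> nat \<Rightarrow> (nat \<Rightarrow> real \<Rightarrow> 'a) \<Rightarrow> nat \<Rightarrow> (nat \<Rightarrow> complex \<Rightarrow> 'a) \<Rightarrow> bool" where
  "parametrized_pseudo_link X n \<gamma> k \<delta> \<longleftrightarrow>
     (\<forall>i<n. regular_closed_curve X (\<gamma> i)) \<and>
     (\<forall>j<k. embedded_disc X (\<delta> j) \<and> precrossing_disc n \<gamma> (\<delta> j)) \<and>
     (\<forall>j<k. \<forall>j'<k. j \<noteq> j' \<longrightarrow> \<delta> j ` cball 0 1 \<inter> \<delta> j' ` cball 0 1 = {}) \<and>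
     (\<forall>i<n. \<forall>i'<n. \<forall>s s'. \<gamma> i s = \<gamma> i' s' \<longrightarrow>
        i = i' \<and> s - s' \<in> \<int> \<or> (\<exists>j<k. \<gamma> i s = \<delta> j 0))"

text \<open>
  A closed curve without preferred parametrization is the set of all its reparametrizations,
  either the orientation preserving ones only (\<open>oriented\<close>) or all of them (\<open>\<not> oriented\<close>).
\<close>

definition circle_reparams :: "bool \<Rightarrow> (real \<Rightarrow> real) set" where
  "circle_reparams oriented =
     {\<rho>. \<rho> C1_differentiable_on UNIV \<and>
        ((\<forall>s. deriv \<rho> s > 0 \<and> \<rho> (s + 1) = \<rho> s + 1) \<or>
         \<not> oriented \<and> (\<forall>s. deriv \<rho> s < 0 \<and> \<rho> (s + 1) = \<rho> s - 1))}"

definition closed_curve :: "bool \<Rightarrow> (real \<Rightarrow> 'a) \<Rightarrow> (real \<Rightarrow> 'a) set" where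
  "closed_curve oriented \<gamma> = (\<lambda>\<rho>. \<gamma> \<circ> \<rho>) ` circle_reparams oriented"

text \<open>
  An (oriented) pseudo link consists of its set of (oriented) closed curves and its set of
  precrossing discs, the latter being subsets of the ambient space.
\<close>

type_synonym 'a pseudo_link = "(real \<Rightarrow> 'a) set set \<times> 'a set set"

definition pseudo_link_of ::
  "bool \<Rightarrow> nat \<Rightarrow> (nat \<Rightarrow> real \<Rightarrow> 'a) \<Rightarrow> nat \<Rightarrow> (nat \<Rightarrow> complex \<Rightarrow> 'a) \<Rightarrow> 'a pseudo_link" where
  "pseudo_link_of oriented n \<gamma> k \<delta> =
     ((\<lambda>i. closed_curve oriented (\<gamma> i)) ` {..<n}, (\<lambda>j. \<delta> j ` cball 0 1) ` {..<k})"

definition pseudo_links :: "bool \<Rightarrow> 'a::euclidean_space set \<Rightarrow> 'a pseudo_link set" where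
  "pseudo_links oriented X =
     {pseudo_link_of oriented n \<gamma> k \<delta> | n \<gamma> k \<delta>. parametrized_pseudo_link X n \<gamma> k \<delta>}"

text \<open>
  An isotopy of arcs and discs is a path of parametrized pseudo links that is continuous for the
  C^1 topology.  (Mere C^0 continuity would allow local knots to be shrunk to a point.)
\<close>

definition pseudo_link_isotopy ::
  "'a::euclidean_space set \<Rightarrow> nat \<Rightarrow> (real \<Rightarrow> nat \<Rightarrow> real \<Rightarrow> 'a) \<Rightarrow>
     nat \<Rightarrow> (real \<Rightarrow> nat \<Rightarrow> complex \<Rightarrow> 'a) \<Rightarrow> bool" where
  "pseudo_link_isotopy X n \<gamma> k \<delta> \<longleftrightarrow>
     (\<forall>t\<in>{0..1}. parametrized_pseudo_link X n (\<gamma> t) k (\<delta> t)) \<and>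
     (\<forall>i<n. continuous_on ({0..1} \<times> UNIV) (\<lambda>(t, s). \<gamma> t i s) \<and>
            continuous_on ({0..1} \<times> UNIV) (\<lambda>(t, s). vector_derivative (\<gamma> t i) (at s))) \<and>
     (\<forall>j<k. continuous_on ({0..1} \<times> cball 0 1) (\<lambda>(t, z). \<delta> t j z) \<and>
            (\<forall>v. continuous_on ({0..1} \<times> cball 0 1) (\<lambda>(t, z). disc_derivative (\<delta> t j) z v)))"

definition isotopic :: "bool \<Rightarrow> 'a::euclidean_space set \<Rightarrow> ('a pseudo_link \<times> 'a pseudo_link) set" where
  "isotopic oriented X =
     {(pseudo_link_of oriented n (\<gamma> 0) k (\<delta> 0), pseudo_link_of oriented n (\<gamma> 1) k (\<delta> 1))
      | n \<gamma> k \<delta>. pseudo_link_isotopy X n \<gamma> k \<delta>}"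

text \<open>Pseudo links in the thickened torus \<open>torus \<times> {0..1}\<close> live in its interior.\<close>

definition torus :: "(complex \<times> complex) set" where
  "torus = sphere 0 1 \<times> sphere 0 1"

definition thickened_torus_interior :: "((complex \<times> complex) \<times> real) set" where
  "thickened_torus_interior = torus \<times> {0<..<1}"

definition S3 :: "(complex \<times> complex) set" where
  "S3 = sphere 0 1"

definition hopf_m :: "real \<Rightarrow> complex \<times> complex" where
  "hopf_m s = (cis (2 * pi * s), 0)"

definition hopf_l :: "real \<Rightarrow> complex \<times> complex" where
  "hopf_l s = (0, cis (2 * pi * s))"

definition hopf_link :: "bool \<Rightarrow> (real \<Rightarrow> complex \<times> complex) set set" where
  "hopf_link oriented = {closed_curve oriented hopf_m, closed_curve oriented hopf_l}"

definition curve_points :: "(real \<Rightarrow> 'a) set set \<Rightarrow> 'a set" where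
  "curve_points C = (\<Union>c\<in>C. \<Union>\<gamma>\<in>c. range \<gamma>)"

text \<open>No precrossing disc may meet both the fixed part \<open>hopf_link\<close> and the moving part.\<close>

definition hopf_mixed_pseudo_links :: "bool \<Rightarrow> (complex \<times> complex) pseudo_link set" where
  "hopf_mixed_pseudo_links oriented =
     {(C, P). (C, P) \<in> pseudo_links oriented S3 \<and> hopf_link oriented \<subseteq> C \<and>
        (\<forall>D\<in>P. \<not> (D \<inter> curve_points (hopf_link oriented) \<noteq> {} \<and>
                   D \<inter> curve_points (C - hopf_link oriented) \<noteq> {}))}"

definition hopf_mixed_isotopic ::
  "bool \<Rightarrow> ((complex \<times> complex) pseudo_link \<times> (complex \<times> complex) pseudo_link) set" where
  "hopf_mixed_isotopic oriented =
     {(pseudo_link_of oriented n (\<gamma> 0) k (\<delta> 0), pseudo_link_of oriented n (\<gamma> 1) k (\<delta> 1))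
      | n \<gamma> k \<delta>. pseudo_link_isotopy S3 n \<gamma> k \<delta> \<and>
          (\<forall>t\<in>{0..1}. pseudo_link_of oriented n (\<gamma> t) k (\<delta> t) \<in> hopf_mixed_pseudo_links oriented) \<and>
          (\<exists>i<n. \<exists>i'<n. \<forall>t\<in>{0..1}. \<gamma> t i = hopf_m \<and> \<gamma> t i' = hopf_l)}"

text \<open>
  The identification of the interior of the thickened torus with the complement of the Hopf link:
  the inner boundary torus is collapsed onto \<open>m\<close> and the outer one onto \<open>l\<close>.
\<close>

definition torus_to_S3 :: "(complex \<times> complex) \<times> real \<Rightarrow> complex \<times> complex" where
  "torus_to_S3 = (\<lambda>((u, v), r).
     (complex_of_real (cos (pi * r / 2)) * u, complex_of_real (sin (pi * r / 2)) * v))"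

definition S3_to_torus :: "complex \<times> complex \<Rightarrow> (complex \<times> complex) \<times> real" where
  "S3_to_torus = (\<lambda>(z, w). ((sgn z, sgn w), 2 / pi * arctan (norm w / norm z)))"

definition map_pseudo_link :: "('a \<Rightarrow> 'b) \<Rightarrow> 'a pseudo_link \<Rightarrow> 'b pseudo_link" where
  "map_pseudo_link h K = ((\<lambda>c. (\<lambda>\<gamma>. h \<circ> \<gamma>) ` c) ` fst K, (\<lambda>D. h ` D) ` snd K)"

definition hopf_union ::
  "bool \<Rightarrow> ((complex \<times> complex) \<times> real) pseudo_link \<Rightarrow> (complex \<times> complex) pseudo_link" where
  "hopf_union oriented K =
     (hopf_link oriented \<union> fst (map_pseudo_link torus_to_S3 K), snd (map_pseudo_link torus_to_S3 K))"

lemma S3_minus_hopf: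
  "S3 - (range hopf_m \<union> range hopf_l) = {(z, w). (norm z)\<^sup>2 + (norm w)\<^sup>2 = 1 \<and> z \<noteq> 0 \<and> w \<noteq> 0}"
proof -
  have circ: "\<exists>s. z = cis (2 * pi * s)" if "norm z = 1" for z :: complex
  proof
    have "z = cis (Arg z)" using that
      by (metis cis_Arg norm_zero sgn_eq div_by_1 of_real_1 zero_neq_one)
    then show "z = cis (2 * pi * (Arg z / (2 * pi)))" by simp
  qed
  have sq: "(norm z)\<^sup>2 = 1 \<longleftrightarrow> norm z = 1" for z :: complex
    using norm_ge_zero[of z] by (auto simp: power2_eq_1_iff simp del: norm_ge_zero)
  have S: "(z, w) \<in> S3 \<longleftrightarrow> (norm z)\<^sup>2 + (norm w)\<^sup>2 = 1" for z w
    by (simp add: S3_def norm_Pair)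
  show ?thesis
  proof (intro set_eqI, clarify)
    fix z w :: complex
    have m: "(z, w) \<in> range hopf_m \<longleftrightarrow> norm z = 1 \<and> w = 0"
      using circ[of z] by (auto simp: hopf_m_def)
    have l: "(z, w) \<in> range hopf_l \<longleftrightarrow> norm w = 1 \<and> z = 0"
      using circ[of w] by (auto simp: hopf_l_def)
    show "(z, w) \<in> S3 - (range hopf_m \<union> range hopf_l) \<longleftrightarrow>
      (z, w) \<in> {(z, w). (norm z)\<^sup>2 + (norm w)\<^sup>2 = 1 \<and> z \<noteq> 0 \<and> w \<noteq> 0}"
      using m l S[of z w] sq[of z] sq[of w] by auto
  qed
qed

lemma homeomorphism_torus_to_S3:
  "homeomorphism thickened_torus_interior (S3 - (range hopf_m \<union> range hopf_l))
     torus_to_S3 S3_to_torus"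
proof (rule homeomorphismI)
  have pos: "cos (pi * r / 2) > 0 \<and> sin (pi * r / 2) > 0" if "0 < r" "r < 1" for r :: real
  proof -
    have "pi * r / 2 < pi / 2" "0 < pi * r / 2" using that by auto
    then show ?thesis by (auto intro!: cos_gt_zero sin_gt_zero2)
  qed
  show "continuous_on thickened_torus_interior torus_to_S3"
    unfolding torus_to_S3_def case_prod_unfold by (intro continuous_intros) simp_all
  show "continuous_on (S3 - (range hopf_m \<union> range hopf_l)) S3_to_torus"
    unfolding S3_to_torus_def case_prod_unfold S3_minus_hopf sgn_div_norm
    by (intro continuous_on_Pair continuous_on_scaleR continuous_on_inverse continuous_on_mult
        continuous_on_const continuous_on_arctan continuous_on_divide continuous_on_norm
        continuous_on_fst continuous_on_snd continuous_on_id) auto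
  show "torus_to_S3 ` thickened_torus_interior \<subseteq> S3 - (range hopf_m \<union> range hopf_l)"
  proof (intro image_subsetI)
    fix x assume "x \<in> thickened_torus_interior"
    then obtain u v r where x: "x = ((u, v), r)" and r: "0 < r" "r < 1"
      and u: "norm u = 1" and v: "norm v = 1"
      by (auto simp: thickened_torus_interior_def torus_def)
    have "u \<noteq> 0" "v \<noteq> 0" using u v by auto
    then show "torus_to_S3 x \<in> S3 - (range hopf_m \<union> range hopf_l)"
      using pos[OF r] u v
      unfolding S3_minus_hopf by (simp add: x torus_to_S3_def norm_mult complex_eq_iff)
  qed
  show "S3_to_torus ` (S3 - (range hopf_m \<union> range hopf_l)) \<subseteq> thickened_torus_interior"
  proof (intro image_subsetI)
    fix y assume y': "y \<in> S3 - (range hopf_m \<union> range hopf_l)"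
    obtain z w where y: "y = (z, w)" by (metis prod.exhaust)
    have z: "z \<noteq> 0" and w: "w \<noteq> 0"
      using y' unfolding S3_minus_hopf by (auto simp: y)
    define a where "a = arctan (norm w / norm z)"
    have a: "0 < a" "a < pi / 2" using z w arctan_ubound[of "norm w / norm z"] by (auto simp: a_def)
    have "2 / pi * a < 2 / pi * (pi / 2)" using a by (intro mult_strict_left_mono) auto
    then have "2 / pi * a < 1" by simp
    moreover have "0 < 2 / pi * a" using a by simp
    ultimately show "S3_to_torus y \<in> thickened_torus_interior" using z w
      by (simp add: y S3_to_torus_def thickened_torus_interior_def torus_def norm_sgn
          flip: a_def)
  qed
  show "S3_to_torus (torus_to_S3 x) = x" if "x \<in> thickened_torus_interior" for x
  proof -
    obtain u v r where x: "x = ((u, v), r)" by (metis prod.exhaust)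
    have r: "0 < r" "r < 1" and u: "norm u = 1" and v: "norm v = 1"
      using that by (auto simp: x thickened_torus_interior_def torus_def)
    define a where "a = pi * r / 2"
    have c: "cos a > 0" and s: "sin a > 0" using pos[OF r] by (auto simp: a_def)
    have a: "0 < a" "a < pi / 2" using r by (auto simp: a_def)
    have "arctan (sin a / cos a) = a"
      using arctan_tan[of a] a by (simp add: tan_def)
    moreover have "2 / pi * a = r" by (simp add: a_def)
    moreover have "sgn (complex_of_real (cos a) * u) = u" "sgn (complex_of_real (sin a) * v) = v"
      using c s u v by (simp_all add: sgn_eq norm_mult)
    ultimately show ?thesis using c s u v
      by (simp add: x S3_to_torus_def torus_to_S3_def norm_mult flip: a_def)
  qed
  show "torus_to_S3 (S3_to_torus y) = y" if "y \<in> S3 - (range hopf_m \<union> range hopf_l)" for y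
  proof -
    obtain z w where y: "y = (z, w)" by (metis prod.exhaust)
    have e: "(norm z)\<^sup>2 + (norm w)\<^sup>2 = 1" and z: "z \<noteq> 0" and w: "w \<noteq> 0"
      using that unfolding S3_minus_hopf by (auto simp: y)
    define b where "b = norm w / norm z"
    have "1 + b\<^sup>2 = ((norm z)\<^sup>2 + (norm w)\<^sup>2) / (norm z)\<^sup>2"
      using z by (simp add: b_def power_divide add_divide_distrib)
    also have "\<dots> = (1 / norm z)\<^sup>2" by (simp add: e power_divide)
    finally have q: "sqrt (1 + b\<^sup>2) = 1 / norm z" by (simp add: real_sqrt_abs)
    have "cos (arctan b) = norm z" "sin (arctan b) = norm w"
      using z by (simp_all add: cos_arctan sin_arctan q) (simp add: b_def)
    moreover have "pi * (2 / pi * arctan b) / 2 = arctan b" by simp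
    moreover have "complex_of_real (norm z) * sgn z = z" "complex_of_real (norm w) * sgn w = w"
      using z w by (simp_all add: sgn_eq)
    ultimately show ?thesis
      by (simp add: y S3_to_torus_def torus_to_S3_def flip: b_def)
  qed
qed

end

theory Submission
  imports Defs
begin

text \<open>
  The diffeomorphism between the interior of the thickened torus and the complement of the Hopf
  link transports pseudo links and their isotopies in both directions, so it remains to compare
  pseudo links in the complement with H-mixed ones.  Adding the Hopf link is harmless.  Conversely,
  no precrossing disc of a mixed pseudo link meets the Hopf link: both of its strands would
  run along the same Hopf circle, so that the derivative of the disc at its centre would map two
  independent directions into one tangent line.  Hence the moving part lies in the complement,
  \<open>hopf_union\<close> is a bijection of the pseudo links themselves, and two pseudo links are isotopic
  if and only if their images are.
\<close>

section \<open>Transport along C^1 embeddings\<close>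

text \<open>Derivatives are those of maps between the surrounding Euclidean spaces, of real
  dimensions 5 and 4, while both manifolds have dimension 3. The two maps are mutually inverse on
  the manifolds only, and neither ambient differential is injective: one lowers the dimension, the
  other kills the radial direction. Regularity of curves and discs is therefore carried over by
  differentiating \<open>g \<circ> (h \<circ> \<gamma>) = \<gamma>\<close>, an identity that holds
  along the object itself. A second difficulty is that a pseudo link is a set of classes of curves,
  while precrossings and isotopies speak of numbered parametrizations. Adding H appends two numbers;
  removing it must delete exactly two and renumber the others. That no third number carries a Hopf
  circle follows once the discs are known to miss H, since curves with different numbers share
  points only at centres of discs. An isotopy class is the set of all pseudo links related to a
  given one, so a bijection that carries one isotopy relation exactly onto the other induces a
  bijection of classes.\<close>

lemma has_derivative_within_convex_unique:
  fixes f :: "'a::real_normed_vector \<Rightarrow> 'b::real_normed_vector"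
  assumes S: "convex S" "interior S \<noteq> {}" and x: "x \<in> S"
    and L: "(f has_derivative L) (at x within S)"
    and L': "(f has_derivative L') (at x within S)"
  shows "L = L'"
proof
  fix v :: 'a
  interpret L: bounded_linear L using L by (rule has_derivative_bounded_linear)
  interpret L': bounded_linear L' using L' by (rule has_derivative_bounded_linear)
  \<comment> \<open>Convexity keeps the segment from \<open>x\<close> to \<open>w\<close> inside
    \<open>S\<close>, and a derivative on a nondegenerate closed interval is unique. So all
    derivatives within \<open>S\<close> agree on \<open>w - x\<close>.\<close>
  have dir: "(f \<circ> (\<lambda>t. x + t *\<^sub>R (w - x)) has_vector_derivative M (w - x)) (at 0 within cbox 0 1)"
    if w: "w \<in> S" and M: "(f has_derivative M) (at x within S)" for w M
  proof -
    interpret M: bounded_linear M using M by (rule has_derivative_bounded_linear)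
    have "x + t *\<^sub>R (w - x) \<in> S" if "t \<in> cbox 0 1" for t
      using convexD_alt[OF S(1) x w, of t] that by (simp add: algebra_simps)
    then have sub: "(\<lambda>t. x + t *\<^sub>R (w - x)) ` cbox 0 1 \<subseteq> S" by blast
    have "((\<lambda>t. x + t *\<^sub>R (w - x)) has_derivative (\<lambda>t. t *\<^sub>R (w - x))) (at 0 within cbox 0 1)"
      by (auto intro!: derivative_eq_intros)
    then have "(f \<circ> (\<lambda>t. x + t *\<^sub>R (w - x)) has_derivative M \<circ> (\<lambda>t. t *\<^sub>R (w - x))) (at 0 within cbox 0 1)"
      by (rule diff_chain_within) (use has_derivative_subset[OF M sub] in simp)
    then show ?thesis by (simp add: has_vector_derivative_def o_def M.scaleR)
  qed
  have eq: "L (w - x) = L' (w - x)" if "w \<in> S" for w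
    by (rule vector_derivative_unique_within_closed_interval[OF _ _ dir[OF that L] dir[OF that L']]) auto
  obtain c e where e: "e > 0" and ball: "ball c e \<subseteq> S"
    using S(2) by (auto simp: mem_interior)
  \<comment> \<open>\<open>x\<close> may lie on the boundary, where \<open>v\<close> need not point
    into \<open>S\<close>. But a small multiple of \<open>v\<close> is a difference of two points of
    an interior ball, hence a difference of two directions from \<open>x\<close> to points of
    \<open>S\<close>. The summand 1 keeps the quotient \<open>d\<close> meaningful for
    \<open>v = 0\<close>.\<close>
  define N where "N = norm v + 1"
  define d where "d = e / (2 * N)"
  have N: "N > 0" by (simp add: N_def add_nonneg_pos)
  then have d: "d > 0" using e by (simp add: d_def)
  have "norm (d *\<^sub>R v) = d * norm v" using d by simp
  also have "\<dots> < d * N" using d by (intro mult_strict_left_mono) (auto simp: N_def)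
  also have "\<dots> = e / 2" using N by (simp add: d_def)
  finally have "c + d *\<^sub>R v \<in> ball c e" using e by (simp add: dist_norm)
  then have w: "c + d *\<^sub>R v \<in> S" and c: "c \<in> S" using ball e by auto
  have "d *\<^sub>R v = (c + d *\<^sub>R v - x) - (c - x)" by simp
  then have "L (d *\<^sub>R v) = L' (d *\<^sub>R v)"
    by (metis L.diff L'.diff eq w c)
  then show "L v = L' v" using d by (simp add: L.scaleR L'.scaleR)
qed

text \<open>\<open>frechet_derivative\<close> chooses some derivative. On the closed disc, boundary
  included, there is only one, so whatever the chain rule yields is the chosen one.\<close>

lemma disc_derivative_eqI:
  assumes "(\<delta> has_derivative L) (at z within cball 0 1)" and "z \<in> cball 0 1"
  shows "disc_derivative \<delta> z = L"
proof (rule has_derivative_within_convex_unique[where S = "cball 0 1"])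
  show "(\<delta> has_derivative disc_derivative \<delta> z) (at z within cball 0 1)"
    using assms(1) frechet_derivative_works[of \<delta> "at z within cball 0 1"]
    by (auto simp: differentiable_def)
qed (use assms in auto)

lemma embedded_disc_has_derivative:
  assumes "embedded_disc X \<delta>" and "z \<in> cball 0 1"
  shows "(\<delta> has_derivative disc_derivative \<delta> z) (at z within cball 0 1)"
  using assms by (auto simp: embedded_disc_def differentiable_on_def frechet_derivative_works)

lemma regular_closed_curve_has_vector_derivative:
  assumes "regular_closed_curve X \<gamma>"
  shows "(\<gamma> has_vector_derivative vector_derivative \<gamma> (at s)) (at s)"
  using assms by (simp add: regular_closed_curve_def C1_differentiable_on_eq vector_derivative_works)

lemma regular_closed_curve_continuous:
  assumes "regular_closed_curve X \<gamma>"
  shows "continuous_on UNIV \<gamma>" and "continuous_on UNIV (\<lambda>s. vector_derivative \<gamma> (at s))"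
  using assms regular_closed_curve_has_vector_derivative[OF assms]
  by (auto simp: regular_closed_curve_def C1_differentiable_on_eq
      intro!: continuous_at_imp_continuous_on has_vector_derivative_continuous)

lemma regular_closed_curve_range_subset:
  "regular_closed_curve X \<gamma> \<Longrightarrow> range \<gamma> \<subseteq> Y \<Longrightarrow> regular_closed_curve Y \<gamma>"
  by (simp add: regular_closed_curve_def)

lemma embedded_disc_image_subset:
  "embedded_disc X \<delta> \<Longrightarrow> \<delta> ` cball 0 1 \<subseteq> Y \<Longrightarrow> embedded_disc Y \<delta>"
  by (simp add: embedded_disc_def)

text \<open>Instantiated in both directions between the two ambient manifolds. The derivative of
  \<open>g\<close> is what shows that \<open>h'\<close> kills no velocity of a regular curve.
  Continuity of \<open>h'\<close> is joint in point and vector because along an isotopy both vary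
  with time.\<close>

locale C1_embedding =
  fixes X :: "'a::euclidean_space set" and Y :: "'b::euclidean_space set"
    and h h' g g'
  assumes maps_to: "x \<in> X \<Longrightarrow> h x \<in> Y"
    and left_inverse: "x \<in> X \<Longrightarrow> g (h x) = x"
    and has_derivative_map: "x \<in> X \<Longrightarrow> (h has_derivative h' x) (at x)"
    and continuous_derivative: "continuous_on (X \<times> UNIV) (\<lambda>(x, v). h' x v)"
    and has_derivative_inverse: "y \<in> Y \<Longrightarrow> (g has_derivative g' y) (at y)"
begin

lemma continuous_map: "continuous_on X h"
  using has_derivative_map has_derivative_continuous continuous_at_imp_continuous_on by blast

lemma inj_on_map: "inj_on h X"
  using left_inverse by (metis inj_onI)

lemma continuous_on_derivative_comp:
  assumes "continuous_on T f" "f ` T \<subseteq> X" "continuous_on T f'"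
  shows "continuous_on T (\<lambda>x. h' (f x) (f' x))"
  using continuous_on_compose2[OF continuous_derivative continuous_on_Pair[OF assms(1,3)]] assms(2)
  by auto

lemma has_vector_derivative_comp:
  assumes "(\<gamma> has_vector_derivative v) (at s)" "\<gamma> s \<in> X"
  shows "(h \<circ> \<gamma> has_vector_derivative h' (\<gamma> s) v) (at s)"
  using assms has_derivative_map[OF assms(2)]
  by (metis has_derivative_at_withinI vector_derivative_diff_chain_within)

lemma regular_closed_curve_vector_derivative_comp:
  assumes "regular_closed_curve X \<gamma>"
  shows "vector_derivative (h \<circ> \<gamma>) (at s) = h' (\<gamma> s) (vector_derivative \<gamma> (at s))"
proof -
  have "\<gamma> s \<in> X" using assms by (auto simp: regular_closed_curve_def)
  then show ?thesis
    using has_vector_derivative_comp[OF regular_closed_curve_has_vector_derivative[OF assms]]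
    by (blast intro: vector_derivative_at)
qed

lemma regular_closed_curve_comp:
  assumes \<gamma>: "regular_closed_curve X \<gamma>"
  shows "regular_closed_curve Y (h \<circ> \<gamma>)"
proof -
  have X: "\<gamma> s \<in> X" for s using \<gamma> by (auto simp: regular_closed_curve_def)
  have D: "(h \<circ> \<gamma> has_vector_derivative h' (\<gamma> s) (vector_derivative \<gamma> (at s))) (at s)" for s
    using has_vector_derivative_comp[OF regular_closed_curve_has_vector_derivative[OF \<gamma>] X] .
  have C: "continuous_on UNIV (\<lambda>s. h' (\<gamma> s) (vector_derivative \<gamma> (at s)))"
    by (rule continuous_on_derivative_comp) (use X regular_closed_curve_continuous[OF \<gamma>] in auto)
  \<comment> \<open>Differentiating \<open>g \<circ> (h \<circ> \<gamma>) = \<gamma>\<close>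
    expresses the velocity of \<open>\<gamma>\<close> as a linear image of that of
    \<open>h \<circ> \<gamma>\<close>, so if the latter vanished, so would the former.\<close>
  have "h' (\<gamma> s) (vector_derivative \<gamma> (at s)) \<noteq> 0" for s
  proof
    assume 0: "h' (\<gamma> s) (vector_derivative \<gamma> (at s)) = 0"
    have gD: "(g has_derivative g' ((h \<circ> \<gamma>) s)) (at ((h \<circ> \<gamma>) s))"
      using has_derivative_inverse[OF maps_to[OF X[of s]]] by (simp only: comp_apply)
    have "g \<circ> (h \<circ> \<gamma>) = \<gamma>" using X left_inverse by auto
    moreover have "(g \<circ> (h \<circ> \<gamma>) has_vector_derivative
        g' ((h \<circ> \<gamma>) s) (h' (\<gamma> s) (vector_derivative \<gamma> (at s)))) (at s)"
      by (rule vector_derivative_diff_chain_within[OF D has_derivative_at_withinI]) (rule gD)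
    moreover have "g' ((h \<circ> \<gamma>) s) 0 = 0"
      using has_derivative_inverse[OF maps_to[OF X]]
      by (auto dest: has_derivative_bounded_linear intro: linear_0 bounded_linear.linear)
    ultimately have "vector_derivative \<gamma> (at s) = 0"
      using 0 by (simp add: vector_derivative_at)
    then show False using \<gamma> by (auto simp: regular_closed_curve_def)
  qed
  moreover have "(h \<circ> \<gamma>) C1_differentiable_on UNIV"
    unfolding C1_differentiable_on_def
    by (rule exI[of _ "\<lambda>s. h' (\<gamma> s) (vector_derivative \<gamma> (at s))"]) (simp add: D C)
  ultimately show ?thesis
    using \<gamma> X maps_to by (auto simp: regular_closed_curve_def vector_derivative_at[OF D])
qed

lemma disc_has_derivative_comp:
  assumes \<delta>: "embedded_disc X \<delta>" and z: "z \<in> cball 0 1"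
  shows "(h \<circ> \<delta> has_derivative h' (\<delta> z) \<circ> disc_derivative \<delta> z) (at z within cball 0 1)"
proof -
  have "\<delta> z \<in> X" using \<delta> z by (auto simp: embedded_disc_def)
  then show ?thesis
    using embedded_disc_has_derivative[OF assms] has_derivative_map
    by (intro diff_chain_within) (auto intro: has_derivative_at_withinI)
qed

lemma disc_derivative_comp:
  assumes "embedded_disc X \<delta>" and "z \<in> cball 0 1"
  shows "disc_derivative (h \<circ> \<delta>) z = h' (\<delta> z) \<circ> disc_derivative \<delta> z"
  using disc_derivative_eqI[OF disc_has_derivative_comp] assms by blast

lemma embedded_disc_comp:
  assumes \<delta>: "embedded_disc X \<delta>"
  shows "embedded_disc Y (h \<circ> \<delta>)"
proof -
  have X: "\<delta> z \<in> X" if "z \<in> cball 0 1" for z using \<delta> that by (auto simp: embedded_disc_def)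
  have cont: "continuous_on (cball 0 1) \<delta>"
    using \<delta> by (auto simp: embedded_disc_def intro: differentiable_imp_continuous_on)
  have "continuous_on (cball 0 1) (\<lambda>z. disc_derivative (h \<circ> \<delta>) z v)" for v
  proof -
    have "continuous_on (cball 0 1) (\<lambda>z. h' (\<delta> z) (disc_derivative \<delta> z v))"
      using \<delta> X cont by (intro continuous_on_derivative_comp) (auto simp: embedded_disc_def)
    then show ?thesis
      by (rule continuous_on_eq) (simp add: disc_derivative_comp[OF \<delta>])
  qed
  \<comment> \<open>The derivative of \<open>\<delta>\<close> factors through that of
    \<open>h \<circ> \<delta>\<close>, and the inner factor of an injective composition is
    injective. Since \<open>g\<close> undoes \<open>h\<close> only on the closed disc, the
    factorization rests on uniqueness of derivatives within that disc.\<close>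
  moreover have "inj (disc_derivative (h \<circ> \<delta>) z)" if z: "z \<in> cball 0 1" for z
  proof -
    have gD: "(g has_derivative g' ((h \<circ> \<delta>) z)) (at ((h \<circ> \<delta>) z))"
      using has_derivative_inverse[OF maps_to[OF X[OF z]]] by (simp only: comp_apply)
    have "(g \<circ> (h \<circ> \<delta>) has_derivative g' ((h \<circ> \<delta>) z) \<circ> (h' (\<delta> z) \<circ> disc_derivative \<delta> z))
        (at z within cball 0 1)"
      by (rule diff_chain_within[OF disc_has_derivative_comp[OF \<delta> z] has_derivative_at_withinI]) (rule gD)
    then have "(\<delta> has_derivative g' ((h \<circ> \<delta>) z) \<circ> (h' (\<delta> z) \<circ> disc_derivative \<delta> z))
        (at z within cball 0 1)"
      by (rule has_derivative_transform[OF z, rotated]) (simp add: left_inverse X)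
    then have "disc_derivative \<delta> z = g' ((h \<circ> \<delta>) z) \<circ> (h' (\<delta> z) \<circ> disc_derivative \<delta> z)"
      using z by (rule disc_derivative_eqI)
    then have "inj (g' ((h \<circ> \<delta>) z) \<circ> (h' (\<delta> z) \<circ> disc_derivative \<delta> z))"
      using \<delta> z by (simp add: embedded_disc_def)
    then show ?thesis
      unfolding disc_derivative_comp[OF \<delta> z] by (rule inj_on_imageI2)
  qed
  moreover have "(h \<circ> \<delta>) differentiable_on cball 0 1"
    using disc_has_derivative_comp[OF \<delta>] unfolding differentiable_on_def differentiable_def by blast
  moreover have "inj_on (h \<circ> \<delta>) (cball 0 1)"
    using \<delta> by (intro comp_inj_on inj_on_subset[OF inj_on_map]) (auto simp: embedded_disc_def)
  ultimately show ?thesis using X maps_to by (auto simp: embedded_disc_def)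
qed

lemma precrossing_disc_comp:
  assumes \<gamma>: "\<And>i s. i < n \<Longrightarrow> \<gamma> i s \<in> X" and \<delta>: "\<delta> ` cball 0 1 \<subseteq> X"
    and "precrossing_disc n \<gamma> \<delta>"
  shows "precrossing_disc n (\<lambda>i. h \<circ> \<gamma> i) (h \<circ> \<delta>)"
proof -
  \<comment> \<open>Injectivity of \<open>h\<close> on \<open>X\<close> pulls incidences back: an
    image curve meets the image disc only where the original curve meets the original disc. Hence
    the same indices and parameter intervals serve.\<close>
  have "\<gamma> j s \<in> \<delta> ` cball 0 1" if "j < n" "(h \<circ> \<gamma> j) s \<in> (h \<circ> \<delta>) ` cball 0 1" for j s
  proof -
    have "h (\<gamma> j s) \<in> h ` (\<delta> ` cball 0 1)" using that by (simp add: image_comp)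
    then show ?thesis
      using \<gamma>[OF that(1)] \<delta> by (simp only: inj_on_image_mem_iff[OF inj_on_map])
  qed
  then show ?thesis
    using assms(3) unfolding precrossing_disc_def image_comp[symmetric] by metis
qed

lemma parametrized_pseudo_link_comp:
  assumes L: "parametrized_pseudo_link X n \<gamma> k \<delta>"
  shows "parametrized_pseudo_link Y n (\<lambda>i. h \<circ> \<gamma> i) k (\<lambda>j. h \<circ> \<delta> j)"
proof -
  have "regular_closed_curve X (\<gamma> i)" if "i < n" for i
    using L that by (simp add: parametrized_pseudo_link_def)
  then have \<gamma>: "\<gamma> i s \<in> X" if "i < n" for i s
    using that unfolding regular_closed_curve_def by blast
  have \<delta>: "\<delta> j ` cball 0 1 \<subseteq> X" if "j < k" for j
    using L that by (auto simp: parametrized_pseudo_link_def embedded_disc_def)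
  have "(h \<circ> \<delta> j) ` cball 0 1 \<inter> (h \<circ> \<delta> j') ` cball 0 1 = {}" if "j < k" "j' < k" "j \<noteq> j'" for j j'
  proof -
    have "\<delta> j ` cball 0 1 \<inter> \<delta> j' ` cball 0 1 = {}"
      using L that by (simp add: parametrized_pseudo_link_def)
    then show ?thesis
      using inj_on_image_Int[OF inj_on_map \<delta>[OF that(1)] \<delta>[OF that(2)]]
      unfolding image_comp[symmetric] by simp
  qed
  moreover have "i = i' \<and> s - s' \<in> \<int> \<or> (\<exists>j<k. (h \<circ> \<gamma> i) s = (h \<circ> \<delta> j) 0)"
    if "i < n" "i' < n" "(h \<circ> \<gamma> i) s = (h \<circ> \<gamma> i') s'" for i i' s s'
  proof -
    have "\<gamma> i s = \<gamma> i' s'" using that \<gamma> inj_on_map by (auto dest: inj_onD)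
    then show ?thesis
      using L that(1,2) unfolding parametrized_pseudo_link_def by (metis comp_apply)
  qed
  moreover have pre: "precrossing_disc n (\<lambda>i. h \<circ> \<gamma> i) (h \<circ> \<delta> j)" if "j < k" for j
    by (rule precrossing_disc_comp, erule \<gamma>, rule \<delta>[OF that])
      (use L that in \<open>simp add: parametrized_pseudo_link_def\<close>)
  ultimately show ?thesis
    using L regular_closed_curve_comp embedded_disc_comp pre
    by (simp add: parametrized_pseudo_link_def)
qed

lemma pseudo_link_isotopy_comp:
  assumes I: "pseudo_link_isotopy X n \<gamma> k \<delta>"
  shows "pseudo_link_isotopy Y n (\<lambda>t i. h \<circ> \<gamma> t i) k (\<lambda>t j. h \<circ> \<delta> t j)"
proof -
  have L: "parametrized_pseudo_link X n (\<gamma> t) k (\<delta> t)" if "t \<in> {0..1}" for t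
    using I that by (simp add: pseudo_link_isotopy_def)
  have curve: "regular_closed_curve X (\<gamma> t i)" if "t \<in> {0..1}" "i < n" for t i
    using L[OF that(1)] that(2) by (simp add: parametrized_pseudo_link_def)
  have disc: "embedded_disc X (\<delta> t j)" if "t \<in> {0..1}" "j < k" for t j
    using L[OF that(1)] that(2) by (simp add: parametrized_pseudo_link_def)
  have \<gamma>: "\<gamma> t i s \<in> X" if "t \<in> {0..1}" "i < n" for t i s
    using curve[OF that] by (auto simp: regular_closed_curve_def)
  have \<delta>: "\<delta> t j z \<in> X" if "t \<in> {0..1}" "j < k" "z \<in> cball 0 1" for t j z
    using disc[OF that(1,2)] that(3) by (auto simp: embedded_disc_def)
  show ?thesis
    unfolding pseudo_link_isotopy_def
  proof (intro conjI ballI allI impI)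
    fix i assume i: "i < n"
    have c: "continuous_on ({0..1} \<times> UNIV) (\<lambda>(t, s). \<gamma> t i s)"
      "continuous_on ({0..1} \<times> UNIV) (\<lambda>(t, s). vector_derivative (\<gamma> t i) (at s))"
      using I i by (auto simp: pseudo_link_isotopy_def)
    have sub: "(\<lambda>(t, s). \<gamma> t i s) ` ({0..1} \<times> UNIV) \<subseteq> X" using \<gamma> i by auto
    show "continuous_on ({0..1} \<times> UNIV) (\<lambda>(t, s). (h \<circ> \<gamma> t i) s)"
      using continuous_on_compose2[OF continuous_map c(1) sub] by (simp add: case_prod_unfold)
    show "continuous_on ({0..1} \<times> UNIV) (\<lambda>(t, s). vector_derivative (h \<circ> \<gamma> t i) (at s))"
      using continuous_on_derivative_comp[OF c(1) sub c(2)]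
      by (rule continuous_on_eq)
        (use i in \<open>auto simp: regular_closed_curve_vector_derivative_comp[OF curve]\<close>)
  next
    fix j assume j: "j < k"
    have c: "continuous_on ({0..1} \<times> cball 0 1) (\<lambda>(t, z). \<delta> t j z)"
      "continuous_on ({0..1} \<times> cball 0 1) (\<lambda>(t, z). disc_derivative (\<delta> t j) z v)" for v
      using I j by (auto simp: pseudo_link_isotopy_def)
    have sub: "(\<lambda>(t, z). \<delta> t j z) ` ({0..1} \<times> cball 0 1) \<subseteq> X" using \<delta> j by auto
    show "continuous_on ({0..1} \<times> cball 0 1) (\<lambda>(t, z). (h \<circ> \<delta> t j) z)"
      using continuous_on_compose2[OF continuous_map c(1) sub] by (simp add: case_prod_unfold)
    show "continuous_on ({0..1} \<times> cball 0 1) (\<lambda>(t, z). disc_derivative (h \<circ> \<delta> t j) z v)" for v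
      using continuous_on_derivative_comp[OF c(1) sub c(2)]
      by (rule continuous_on_eq) (use j in \<open>auto simp: disc_derivative_comp[OF disc]\<close>)
  qed (simp add: L parametrized_pseudo_link_comp)
qed

end

section \<open>The complement of the Hopf link\<close>

definition torus_to_S3_deriv ::
  "(complex \<times> complex) \<times> real \<Rightarrow> (complex \<times> complex) \<times> real \<Rightarrow> complex \<times> complex" where
  "torus_to_S3_deriv = (\<lambda>((u, v), r) ((a, b), c).
     (complex_of_real (cos (pi * r / 2)) * a - complex_of_real (sin (pi * r / 2) * (pi * c / 2)) * u,
      complex_of_real (sin (pi * r / 2)) * b + complex_of_real (cos (pi * r / 2) * (pi * c / 2)) * v))"

lemma torus_to_S3_has_derivative: "(torus_to_S3 has_derivative torus_to_S3_deriv x) (at x)"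
  unfolding torus_to_S3_def torus_to_S3_deriv_def case_prod_unfold
  by (auto intro!: derivative_eq_intros simp: algebra_simps)

text \<open>The differential of \<open>sgn\<close> at \<open>z\<close> projects \<open>a\<close>
  orthogonally to \<open>z\<close> and divides by \<open>norm z\<close>. The last entry is the
  quotient rule for \<open>norm w / norm z\<close>, followed by the derivative of
  \<open>arctan\<close>.\<close>

definition S3_to_torus_deriv ::
  "complex \<times> complex \<Rightarrow> complex \<times> complex \<Rightarrow> (complex \<times> complex) \<times> real" where
  "S3_to_torus_deriv = (\<lambda>(z, w) (a, b).
     ((a /\<^sub>R norm z - ((z \<bullet> a) / norm z ^ 3) *\<^sub>R z, b /\<^sub>R norm w - ((w \<bullet> b) / norm w ^ 3) *\<^sub>R w),
      2 / pi * (((w \<bullet> b) / (norm w * norm z) - norm w * (z \<bullet> a) / norm z ^ 3) /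
        (1 + (norm w / norm z)\<^sup>2))))"

lemma norm_has_derivative_inner:
  fixes f :: "'a::real_normed_vector \<Rightarrow> 'b::real_inner"
  assumes "f x \<noteq> 0" "(f has_derivative f') (at x within S)"
  shows "((\<lambda>x. norm (f x)) has_derivative (\<lambda>v. (f x \<bullet> f' v) / norm (f x))) (at x within S)"
  using has_derivative_compose[OF assms(2) has_derivative_norm[OF assms(1)]]
  by (simp add: sgn_div_norm inner_commute divide_inverse mult.commute)

lemma S3_to_torus_has_derivative:
  assumes "y \<in> S3 - (range hopf_m \<union> range hopf_l)"
  shows "(S3_to_torus has_derivative S3_to_torus_deriv y) (at y)"
proof -
  have nz: "fst y \<noteq> 0" "snd y \<noteq> 0" using assms unfolding S3_minus_hopf by auto
  have "((\<lambda>y. arctan (norm (snd y) / norm (fst y))) has_derivative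
      (\<lambda>v. ((snd y \<bullet> snd v) / (norm (snd y) * norm (fst y)) -
        norm (snd y) * (fst y \<bullet> fst v) / norm (fst y) ^ 3) /
        (1 + (norm (snd y) / norm (fst y))\<^sup>2))) (at y)"
    using nz by (auto intro!: derivative_eq_intros norm_has_derivative_inner
        simp: field_simps power2_eq_square power3_eq_cube)
  note D = has_derivative_mult_right[OF this]
  show ?thesis
    unfolding S3_to_torus_def S3_to_torus_deriv_def case_prod_unfold sgn_div_norm
    using nz by (intro has_derivative_Pair D)
      (auto intro!: derivative_eq_intros norm_has_derivative_inner
        simp: field_simps power2_eq_square power3_eq_cube)
qed

abbreviation hopf_points :: "(complex \<times> complex) set" where
  "hopf_points \<equiv> range hopf_m \<union> range hopf_l"

lemma S3_to_torus_deriv_continuous: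
  "continuous_on ((S3 - hopf_points) \<times> UNIV) (\<lambda>(y, v). S3_to_torus_deriv y v)"
proof -
  have "1 + (norm w / norm z)\<^sup>2 \<noteq> 0" for z w :: complex
    by (metis add_pos_nonneg less_irrefl zero_le_power2 zero_less_one)
  then show ?thesis
    unfolding S3_to_torus_deriv_def case_prod_unfold S3_minus_hopf
    by (intro continuous_intros) auto
qed

interpretation to_S3: C1_embedding thickened_torus_interior "S3 - hopf_points"
  torus_to_S3 torus_to_S3_deriv S3_to_torus S3_to_torus_deriv
proof
  show "continuous_on (thickened_torus_interior \<times> UNIV) (\<lambda>(x, v). torus_to_S3_deriv x v)"
    unfolding torus_to_S3_deriv_def case_prod_unfold by (intro continuous_intros) simp_all
qed (use homeomorphism_torus_to_S3 torus_to_S3_has_derivative S3_to_torus_has_derivative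
    in \<open>auto simp: homeomorphism_def\<close>)

interpretation to_torus: C1_embedding "S3 - hopf_points" thickened_torus_interior
  S3_to_torus S3_to_torus_deriv torus_to_S3 torus_to_S3_deriv
proof
  show "S3_to_torus y \<in> thickened_torus_interior" "torus_to_S3 (S3_to_torus y) = y"
    if "y \<in> S3 - hopf_points" for y
    using homeomorphism_torus_to_S3 that by (auto simp: homeomorphism_def)
qed (use torus_to_S3_has_derivative S3_to_torus_has_derivative S3_to_torus_deriv_continuous in auto)

section \<open>Classes of reparametrizations and their point sets\<close>

lemma closed_curve_self: "\<gamma> \<in> closed_curve oriented \<gamma>"
proof -
  have "(\<lambda>s. s) \<in> circle_reparams oriented" by (auto simp: circle_reparams_def)
  then have "\<gamma> \<circ> (\<lambda>s. s) \<in> closed_curve oriented \<gamma>" unfolding closed_curve_def by (rule imageI)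
  then show ?thesis by (simp add: comp_def)
qed

lemma closed_curve_range: "(\<Union>\<phi>\<in>closed_curve oriented \<gamma>. range \<phi>) = range \<gamma>"
proof
  show "(\<Union>\<phi>\<in>closed_curve oriented \<gamma>. range \<phi>) \<subseteq> range \<gamma>" by (auto simp: closed_curve_def)
qed (use closed_curve_self in blast)

lemma closed_curve_eq_range:
  "closed_curve oriented \<gamma> = closed_curve oriented \<gamma>' \<Longrightarrow> range \<gamma> = range \<gamma>'"
  using closed_curve_range by metis

lemma closed_curve_comp:
  "closed_curve oriented (h \<circ> \<gamma>) = (\<lambda>\<phi>. h \<circ> \<phi>) ` closed_curve oriented \<gamma>"
  by (auto simp: closed_curve_def image_image comp_assoc)

lemma map_pseudo_link_of:
  "map_pseudo_link h (pseudo_link_of oriented n \<gamma> k \<delta>) =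
     pseudo_link_of oriented n (\<lambda>i. h \<circ> \<gamma> i) k (\<lambda>j. h \<circ> \<delta> j)"
  by (simp add: map_pseudo_link_def pseudo_link_of_def closed_curve_comp image_image image_comp)

lemma curve_points_hopf_link: "curve_points (hopf_link oriented) = hopf_points"
  by (simp add: curve_points_def hopf_link_def closed_curve_range)

section \<open>The two Hopf circles and their tangent lines\<close>

lemma range_hopf_disjoint: "range hopf_m \<inter> range hopf_l = {}"
  by (auto simp: hopf_m_def hopf_l_def)

lemma cis_2pi_eq_iff: "cis (2 * pi * s) = cis (2 * pi * s') \<longleftrightarrow> s - s' \<in> \<int>"
proof
  assume "cis (2 * pi * s) = cis (2 * pi * s')"
  then have "cos (2 * pi * s - 2 * pi * s') = 1"
    by (simp add: cos_diff complex_eq_iff flip: power2_eq_square)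
  then obtain n :: int where "2 * pi * s - 2 * pi * s' = real_of_int n * 2 * pi"
    unfolding cos_one_2pi_int by blast
  then have "2 * pi * (s - s' - n) = 0" by (simp add: algebra_simps)
  then have "s - s' = n" by simp
  then show "s - s' \<in> \<int>" by simp
next
  assume "s - s' \<in> \<int>"
  then obtain n :: int where "s - s' = n" by (auto elim: Ints_cases)
  then have "2 * pi * s = 2 * pi * s' + 2 * pi * n" by (simp add: algebra_simps)
  then show "cis (2 * pi * s) = cis (2 * pi * s')"
    using cis_multiple_2pi[of "of_int n"] by (simp flip: cis_mult)
qed

lemma hopf_eq_iff: "hopf_m s = hopf_m s' \<longleftrightarrow> s - s' \<in> \<int>" "hopf_l s = hopf_l s' \<longleftrightarrow> s - s' \<in> \<int>"
  by (simp_all add: hopf_m_def hopf_l_def cis_2pi_eq_iff)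

lemma hopf_has_vector_derivative:
  "(hopf_m has_vector_derivative ((2 * pi) *\<^sub>R (\<i> * cis (2 * pi * s)), 0)) (at s)"
  "(hopf_l has_vector_derivative (0, (2 * pi) *\<^sub>R (\<i> * cis (2 * pi * s)))) (at s)"
  unfolding hopf_m_def hopf_l_def has_vector_derivative_def
  by (auto intro!: derivative_eq_intros ext simp: algebra_simps scaleR_conv_of_real)

lemma regular_closed_curve_hopf: "regular_closed_curve S3 hopf_m" "regular_closed_curve S3 hopf_l"
proof -
  note D = hopf_has_vector_derivative
  have per: "hopf_m (s + 1) = hopf_m s" "hopf_l (s + 1) = hopf_l s" for s
    by (simp_all add: hopf_eq_iff)
  have "range hopf_m \<subseteq> S3" "range hopf_l \<subseteq> S3"
    by (auto simp: S3_def hopf_m_def hopf_l_def norm_Pair)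
  moreover have "hopf_m C1_differentiable_on UNIV"
    unfolding C1_differentiable_on_def
    by (intro exI conjI ballI, rule D) (intro continuous_intros)
  moreover have "hopf_l C1_differentiable_on UNIV"
    unfolding C1_differentiable_on_def
    by (intro exI conjI ballI, rule D) (intro continuous_intros)
  ultimately show "regular_closed_curve S3 hopf_m" "regular_closed_curve S3 hopf_l"
    by (simp_all add: regular_closed_curve_def per vector_derivative_at[OF D(1)]
        vector_derivative_at[OF D(2)] zero_prod_def)
qed

text \<open>The circle is described by equations: the second coordinate is 0 and the first has norm
  1. Differentiating them along \<open>f\<close> gives a vector with second part 0 and first part
  orthogonal to \<open>fst (f 0)\<close>. The resulting line depends on the point \<open>f 0\<close>
  alone, so it is common to all curves in the circle through that point.\<close>

lemma tangent_hopf_m: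
  assumes f: "(f has_vector_derivative v) (at 0)" and m: "\<And>t. \<bar>t\<bar> < 1 \<Longrightarrow> f t \<in> range hopf_m"
  shows "v \<in> span {(\<i> * fst (f 0), 0)}"
proof -
  have fs: "((\<lambda>t. fst (f t)) has_vector_derivative fst v) (at 0)"
    "((\<lambda>t. snd (f t)) has_vector_derivative snd v) (at 0)"
    using f by (auto simp: has_vector_derivative_def intro!: derivative_eq_intros)
  \<comment> \<open>Both equations say that some function of \<open>f t\<close> is constant for
    small \<open>t\<close>, so its derivative at 0 vanishes.\<close>
  have const: "w = 0" if "(F has_vector_derivative w) (at 0)" "\<And>t. \<bar>t\<bar> < 1 \<Longrightarrow> F t = c"
    for F :: "real \<Rightarrow> 'b::euclidean_space" and w c
  proof -
    have "((\<lambda>_. c) has_vector_derivative w) (at 0)"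
      using that(1) by (rule has_vector_derivative_transform_within_open[where S = "{-1<..<1}"])
        (use that(2) in auto)
    then show ?thesis using has_vector_derivative_const vector_derivative_unique_at by blast
  qed
  have "snd v = 0" by (rule const[OF fs(2)]) (use m in \<open>force simp: hopf_m_def\<close>)
  have unit: "fst (f t) \<bullet> fst (f t) = 1" if "\<bar>t\<bar> < 1" for t
    using m[OF that] by (auto simp: hopf_m_def dot_square_norm)
  have "((\<lambda>t. fst (f t) \<bullet> fst (f t)) has_vector_derivative
      fst (f 0) \<bullet> fst v + fst v \<bullet> fst (f 0)) (at 0)"
    by (rule bounded_bilinear.has_vector_derivative[OF bounded_bilinear_inner fs(1) fs(1)])
  then have "fst (f 0) \<bullet> fst v + fst v \<bullet> fst (f 0) = 0" by (rule const) (rule unit)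
  then have orth: "Re (fst (f 0)) * Re (fst v) + Im (fst (f 0)) * Im (fst v) = 0"
    by (simp add: inner_complex_def mult.commute)
  have one: "Re (fst (f 0)) * Re (fst (f 0)) + Im (fst (f 0)) * Im (fst (f 0)) = 1"
    using unit[of 0] by (simp add: inner_complex_def)
  \<comment> \<open>The inner product of \<open>fst v\<close> with the unit vector
    \<open>\<i> * fst (f 0)\<close>, that is, the coordinate of \<open>fst v\<close> along the
    tangent line.\<close>
  define r where "r = Re (fst (f 0)) * Im (fst v) - Im (fst (f 0)) * Re (fst v)"
  have "Re (fst v) = - r * Im (fst (f 0))" "Im (fst v) = r * Re (fst (f 0))"
    unfolding r_def using orth one by algebra+
  then have "v = r *\<^sub>R (\<i> * fst (f 0), 0)"
    using \<open>snd v = 0\<close> by (simp add: prod_eq_iff complex_eq_iff)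
  then show ?thesis by (metis span_base span_scale singletonI)
qed

lemma tangent_hopf_l:
  assumes f: "(f has_vector_derivative v) (at 0)" and l: "\<And>t. \<bar>t\<bar> < 1 \<Longrightarrow> f t \<in> range hopf_l"
  shows "v \<in> span {(0, \<i> * snd (f 0))}"
proof -
  have "((\<lambda>t. prod.swap (f t)) has_vector_derivative prod.swap v) (at 0)"
    using f by (auto simp: has_vector_derivative_def prod.swap_def intro!: derivative_eq_intros)
  moreover have "prod.swap (f t) \<in> range hopf_m" if "\<bar>t\<bar> < 1" for t
    using l[OF that] by (auto simp: hopf_m_def hopf_l_def)
  ultimately have "prod.swap v \<in> span {(\<i> * snd (f 0), 0)}"
    using tangent_hopf_m by fastforce
  then obtain r where "prod.swap v = r *\<^sub>R (\<i> * snd (f 0), 0)"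
    by (auto simp: span_singleton)
  then have "v = r *\<^sub>R (0, \<i> * snd (f 0))" by (simp add: prod_eq_iff)
  then show ?thesis by (metis span_base span_scale singletonI)
qed

lemma embedded_disc_diameters_not_in_hopf:
  assumes \<delta>: "embedded_disc X \<delta>"
    and R: "R = range hopf_m \<or> R = range hopf_l"
  shows "\<not> (\<delta> ` closed_segment (-1) 1 \<subseteq> R \<and> \<delta> ` closed_segment (-\<i>) \<i> \<subseteq> R)"
proof
  assume sub: "\<delta> ` closed_segment (-1) 1 \<subseteq> R \<and> \<delta> ` closed_segment (-\<i>) \<i> \<subseteq> R"
  let ?L = "disc_derivative \<delta> 0"
  have "(\<delta> has_derivative ?L) (at 0 within cball 0 1)"
    using embedded_disc_has_derivative[OF \<delta>] by simp
  \<comment> \<open>The centre is interior to the disc, so the derivative within the disc is a full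
    one and straight paths may pass through the centre in both directions.\<close>
  then have D: "(\<delta> has_derivative ?L) (at 0)" by (simp add: at_within_interior[of 0 "cball 0 1"])
  then interpret L: bounded_linear ?L by (rule has_derivative_bounded_linear)
  have inj: "inj ?L" using \<delta> by (auto simp: embedded_disc_def)
  have dir: "((\<lambda>t. \<delta> (t *\<^sub>R u)) has_vector_derivative ?L u) (at 0)" for u
  proof -
    have "((\<lambda>t. t *\<^sub>R u) has_derivative (\<lambda>t. t *\<^sub>R u)) (at 0)" by (auto intro!: derivative_eq_intros)
    then have "((\<lambda>t. \<delta> (t *\<^sub>R u)) has_derivative (\<lambda>t. ?L (t *\<^sub>R u))) (at 0)"
      by (rule has_derivative_compose) (use D in simp)
    then show ?thesis by (simp add: has_vector_derivative_def L.scaleR)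
  qed
  \<comment> \<open>The weight \<open>(1 + t) / 2\<close> solves
    \<open>(1 - x) * (- u) + x * u = t * u\<close> for \<open>x\<close>.\<close>
  have seg: "t *\<^sub>R u \<in> closed_segment (- u) u" if "\<bar>t\<bar> < 1" for t and u :: complex
    unfolding in_segment
    by (rule exI[of _ "(1 + t) / 2"]) (use that in \<open>auto simp: complex_eq_iff field_simps\<close>)
  have R': "\<delta> (t *\<^sub>R u) \<in> R" if "\<bar>t\<bar> < 1" "u \<in> {1, \<i>}" for t u
    using seg[OF that(1), of u] that(2) sub by auto
  obtain w where w: "?L u \<in> span {w}" if "u \<in> {1, \<i>}" for u
    using R
  proof
    assume "R = range hopf_m"
    then show thesis using that[of "(\<i> * fst (\<delta> 0), 0)"] tangent_hopf_m[OF dir] R' by simp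
  next
    assume "R = range hopf_l"
    then show thesis using that[of "(0, \<i> * snd (\<delta> 0))"] tangent_hopf_l[OF dir] R' by simp
  qed
  obtain a b where ab: "?L 1 = a *\<^sub>R w" "?L \<i> = b *\<^sub>R w"
    using w[of 1] w[of \<i>] by (auto simp: span_singleton)
  \<comment> \<open>If the images of 1 and \<open>\<i>\<close> are \<open>a\<close> and
    \<open>b\<close> times \<open>w\<close>, this combination is in the kernel. Injectivity forces
    \<open>a = 0\<close>, after which 1 itself is in the kernel.\<close>
  have "?L (b *\<^sub>R 1 - a *\<^sub>R \<i>) = ?L 0"
    by (simp add: L.diff L.scaleR L.zero ab mult.commute)
  then have "b *\<^sub>R 1 - a *\<^sub>R \<i> = 0" using inj by (metis injD)
  then have "a = 0" by (simp add: complex_eq_iff)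
  then have "?L 1 = ?L 0" by (simp add: ab L.zero)
  then show False using inj by (metis injD zero_neq_one)
qed

section \<open>Adding and removing the Hopf link\<close>

lemma curve_in:
  assumes "parametrized_pseudo_link X n \<gamma> k \<delta>" "i < n"
  shows "\<gamma> i s \<in> X"
proof -
  have "regular_closed_curve X (\<gamma> i)" using assms by (simp add: parametrized_pseudo_link_def)
  then show ?thesis unfolding regular_closed_curve_def by blast
qed

lemma disc_subset:
  assumes "parametrized_pseudo_link X n \<gamma> k \<delta>" "j < k"
  shows "\<delta> j ` cball 0 1 \<subseteq> X"
  using assms by (simp add: parametrized_pseudo_link_def embedded_disc_def)

lemma precrossing_discE:
  assumes "precrossing_disc n \<gamma> \<delta>"
  obtains i i' p q p' q' where "i < n" "i' < n" "p < q" "p' < q'"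
    "\<gamma> i ` {p..q} = \<delta> ` closed_segment (-1) 1" "\<gamma> i' ` {p'..q'} = \<delta> ` closed_segment (-\<i>) \<i>"
    "\<And>j s. j < n \<Longrightarrow> \<gamma> j s \<in> \<delta> ` cball 0 1 \<Longrightarrow>
      \<exists>a\<in>\<int>. j = i \<and> s + a \<in> {p..q} \<or> j = i' \<and> s + a \<in> {p'..q'}"
proof -
  from assms show thesis
    unfolding precrossing_disc_def by - (elim exE conjE, rule that, assumption+, simp only: simp_thms)
qed

lemma precrossing_discI:
  assumes "i < n" "i' < n" "p < q" "p' < q'"
    "\<gamma> i ` {p..q} = \<delta> ` closed_segment (-1) 1" "\<gamma> i' ` {p'..q'} = \<delta> ` closed_segment (-\<i>) \<i>"
    "\<And>j s. j < n \<Longrightarrow> \<gamma> j s \<in> \<delta> ` cball 0 1 \<Longrightarrow>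
      \<exists>a\<in>\<int>. j = i \<and> s + a \<in> {p..q} \<or> j = i' \<and> s + a \<in> {p'..q'}"
  shows "precrossing_disc n \<gamma> \<delta>"
  unfolding precrossing_disc_def
  by (intro exI[of _ i] exI[of _ i'] exI[of _ p] exI[of _ q] exI[of _ p'] exI[of _ q'] conjI allI impI assms)

lemma pseudo_link_of_mem_pseudo_links:
  "parametrized_pseudo_link X n \<gamma> k \<delta> \<Longrightarrow> pseudo_link_of oriented n \<gamma> k \<delta> \<in> pseudo_links oriented X"
  unfolding pseudo_links_def by blast

text \<open>The Hopf circles come after the \<open>n\<close> given curves, so those keep their
  numbers and the strands of each precrossing can be named as before.\<close>

definition with_hopf :: "nat \<Rightarrow> (nat \<Rightarrow> real \<Rightarrow> complex \<times> complex) \<Rightarrow> nat \<Rightarrow> real \<Rightarrow> complex \<times> complex" where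
  "with_hopf n \<gamma> i = (if i < n then \<gamma> i else if i = n then hopf_m else hopf_l)"

lemma with_hopf_simps [simp]:
  "i < n \<Longrightarrow> with_hopf n \<gamma> i = \<gamma> i" "with_hopf n \<gamma> n = hopf_m" "with_hopf n \<gamma> (Suc n) = hopf_l"
  by (simp_all add: with_hopf_def)

lemma pseudo_link_of_with_hopf:
  "pseudo_link_of oriented (n + 2) (with_hopf n \<gamma>) k \<delta> =
     (hopf_link oriented \<union> fst (pseudo_link_of oriented n \<gamma> k \<delta>), snd (pseudo_link_of oriented n \<gamma> k \<delta>))"
proof -
  have "{..<n + 2} = insert n (insert (Suc n) {..<n})" by auto
  then show ?thesis by (auto simp: pseudo_link_of_def hopf_link_def)
qed

lemma hopf_union_pseudo_link_of:
  "hopf_union oriented (pseudo_link_of oriented n \<gamma> k \<delta>) =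
     pseudo_link_of oriented (n + 2) (with_hopf n (\<lambda>i. torus_to_S3 \<circ> \<gamma> i)) k (\<lambda>j. torus_to_S3 \<circ> \<delta> j)"
  unfolding hopf_union_def map_pseudo_link_of pseudo_link_of_with_hopf ..

lemma parametrized_pseudo_link_with_hopf:
  assumes L: "parametrized_pseudo_link (S3 - hopf_points) n \<gamma> k \<delta>"
  shows "parametrized_pseudo_link S3 (n + 2) (with_hopf n \<gamma>) k \<delta>"
proof -
  have idx: "i < n \<or> i = n \<or> i = Suc n" if "i < n + 2" for i using that by auto
  have out: "\<gamma> i s \<noteq> hopf_m s'" "\<gamma> i s \<noteq> hopf_l s'" if "i < n" for i s s'
    using curve_in[OF L that, of s] by auto
  have ml: "hopf_m s \<noteq> hopf_l s'" for s s' using range_hopf_disjoint by blast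
  have reg: "regular_closed_curve S3 (with_hopf n \<gamma> i)" if "i < n + 2" for i
  proof -
    have "regular_closed_curve S3 (\<gamma> i)" if "i < n"
    proof (rule regular_closed_curve_range_subset)
      show "regular_closed_curve (S3 - hopf_points) (\<gamma> i)"
        using L that by (simp add: parametrized_pseudo_link_def)
      show "range (\<gamma> i) \<subseteq> S3" using curve_in[OF L that] by blast
    qed
    then show ?thesis using idx[OF that] regular_closed_curve_hopf by auto
  qed
  have disc: "embedded_disc S3 (\<delta> j)" if "j < k" for j
  proof (rule embedded_disc_image_subset)
    show "embedded_disc (S3 - hopf_points) (\<delta> j)"
      using L that by (simp add: parametrized_pseudo_link_def)
    show "\<delta> j ` cball 0 1 \<subseteq> S3" using disc_subset[OF L that] by blast
  qed
  have pre: "precrossing_disc (n + 2) (with_hopf n \<gamma>) (\<delta> j)" if j: "j < k" for j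
  proof -
    have "precrossing_disc n \<gamma> (\<delta> j)" using L j by (simp add: parametrized_pseudo_link_def)
    then obtain i i' p q p' q' where ii: "i < n" "i' < n" and pq: "p < q" "p' < q'"
      and im: "\<gamma> i ` {p..q} = \<delta> j ` closed_segment (-1) 1"
        "\<gamma> i' ` {p'..q'} = \<delta> j ` closed_segment (-\<i>) \<i>"
      and only: "\<And>l s. l < n \<Longrightarrow> \<gamma> l s \<in> \<delta> j ` cball 0 1 \<Longrightarrow>
        \<exists>a\<in>\<int>. l = i \<and> s + a \<in> {p..q} \<or> l = i' \<and> s + a \<in> {p'..q'}"
      by (rule precrossing_discE) (rule that)
    \<comment> \<open>The clause on who enters a disc now covers two more curves. The disc lies in
      the complement of the Hopf link, so neither of them enters it.\<close>
    have lt: "l < n" if "l < n + 2" "with_hopf n \<gamma> l s \<in> \<delta> j ` cball 0 1" for l s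
    proof -
      have "with_hopf n \<gamma> l s \<in> S3 - hopf_points" using that(2) disc_subset[OF L j] by blast
      then show ?thesis using idx[OF that(1)] by auto
    qed
    have only': "\<exists>a\<in>\<int>. l = i \<and> s + a \<in> {p..q} \<or> l = i' \<and> s + a \<in> {p'..q'}"
      if "l < n + 2" "with_hopf n \<gamma> l s \<in> \<delta> j ` cball 0 1" for l s
    proof (rule only)
      show "l < n" using that by (rule lt)
      then show "\<gamma> l s \<in> \<delta> j ` cball 0 1" using that(2) by (simp only: with_hopf_simps)
    qed
    show ?thesis
      by (rule precrossing_discI[OF _ _ pq _ _ only']) (use ii im in simp_all)
  qed
  have simple: "i = i' \<and> s - s' \<in> \<int> \<or> (\<exists>j<k. with_hopf n \<gamma> i s = \<delta> j 0)"
    if "i < n + 2" "i' < n + 2" and eq: "with_hopf n \<gamma> i s = with_hopf n \<gamma> i' s'" for i i' s s'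
  proof (cases "i < n \<and> i' < n")
    case True
    then show ?thesis using L eq by (simp add: parametrized_pseudo_link_def)
  next
    case False
    then show ?thesis
      using idx[OF that(1)] idx[OF that(2)] eq out out[symmetric] ml ml[symmetric]
      by (auto simp: hopf_eq_iff)
  qed
  show ?thesis
    unfolding parametrized_pseudo_link_def
  proof (intro conjI allI impI)
    show "\<delta> j ` cball 0 1 \<inter> \<delta> j' ` cball 0 1 = {}" if "j < k" "j' < k" "j \<noteq> j'" for j j'
      using L that by (simp add: parametrized_pseudo_link_def)
  qed (fact reg disc pre simple)+
qed

lemma hopf_mixed_pseudo_linksI:
  assumes "L \<in> pseudo_links oriented S3" and "hopf_link oriented \<subseteq> fst L"
    and "\<forall>D\<in>snd L. D \<inter> hopf_points = {}"
  shows "L \<in> hopf_mixed_pseudo_links oriented"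
proof -
  have "(fst L, snd L) \<in> hopf_mixed_pseudo_links oriented"
    unfolding hopf_mixed_pseudo_links_def curve_points_hopf_link mem_Collect_eq case_prod_conv
  proof (intro conjI ballI)
    show "\<not> (D \<inter> hopf_points \<noteq> {} \<and> D \<inter> curve_points (fst L - hopf_link oriented) \<noteq> {})"
      if "D \<in> snd L" for D
      using assms(3) that by simp
  qed (simp_all only: prod.collapse assms)
  then show ?thesis by simp
qed

lemma pseudo_link_of_with_hopf_mem:
  assumes L: "parametrized_pseudo_link (S3 - hopf_points) n \<gamma> k \<delta>"
  shows "pseudo_link_of oriented (n + 2) (with_hopf n \<gamma>) k \<delta> \<in> hopf_mixed_pseudo_links oriented"
proof -
  have "D \<inter> hopf_points = {}" if "D \<in> (\<lambda>j. \<delta> j ` cball 0 1) ` {..<k}" for D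
    using that disc_subset[OF L] by blast
  then have "\<forall>D\<in>snd (pseudo_link_of oriented (n + 2) (with_hopf n \<gamma>) k \<delta>). D \<inter> hopf_points = {}"
    unfolding pseudo_link_of_def snd_conv by blast
  moreover have "hopf_link oriented \<subseteq> fst (pseudo_link_of oriented (n + 2) (with_hopf n \<gamma>) k \<delta>)"
    unfolding pseudo_link_of_with_hopf by simp
  ultimately show ?thesis
    by (rule hopf_mixed_pseudo_linksI
        [OF pseudo_link_of_mem_pseudo_links[OF parametrized_pseudo_link_with_hopf[OF L]], rotated])
qed

text \<open>The appended circles do not move with time, so joint continuity for them reduces to
  continuity of one regular curve and its velocity.\<close>

lemma pseudo_link_isotopy_with_hopf:
  assumes I: "pseudo_link_isotopy (S3 - hopf_points) n \<gamma> k \<delta>"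
  shows "pseudo_link_isotopy S3 (n + 2) (\<lambda>t. with_hopf n (\<gamma> t)) k \<delta>"
proof -
  have const: "continuous_on ({0..1} \<times> UNIV) (\<lambda>(t, s). f s)"
    if "continuous_on UNIV f" for f :: "real \<Rightarrow> complex \<times> complex"
    unfolding case_prod_unfold
    by (rule continuous_on_compose2[OF that]) (auto intro: continuous_intros)
  have "continuous_on ({0..1} \<times> UNIV) (\<lambda>(t, s). with_hopf n (\<gamma> t) i s) \<and>
      continuous_on ({0..1} \<times> UNIV) (\<lambda>(t, s). vector_derivative (with_hopf n (\<gamma> t) i) (at s))"
    if "i < n + 2" for i
  proof -
    have "i < n \<or> i = n \<or> i = Suc n" using that by auto
    then consider "i < n" | "i = n" | "i = Suc n" by blast
    then show ?thesis
    proof cases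
      case 1
      then show ?thesis using I by (simp add: pseudo_link_isotopy_def)
    next
      case 2
      then show ?thesis
        unfolding 2 with_hopf_simps
        by (intro conjI const regular_closed_curve_continuous[OF regular_closed_curve_hopf(1)])
    next
      case 3
      then show ?thesis
        unfolding 3 with_hopf_simps
        by (intro conjI const regular_closed_curve_continuous[OF regular_closed_curve_hopf(2)])
    qed
  qed
  moreover have "parametrized_pseudo_link S3 (n + 2) (with_hopf n (\<gamma> t)) k (\<delta> t)" if "t \<in> {0..1}" for t
    using I that by (intro parametrized_pseudo_link_with_hopf) (simp add: pseudo_link_isotopy_def)
  ultimately show ?thesis
    using I unfolding pseudo_link_isotopy_def by blast
qed

lemma hopf_union_isotopic:
  assumes "(K, K') \<in> isotopic oriented thickened_torus_interior"
  shows "(hopf_union oriented K, hopf_union oriented K') \<in> hopf_mixed_isotopic oriented"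
proof -
  obtain n \<gamma> k \<delta> where K: "K = pseudo_link_of oriented n (\<gamma> 0) k (\<delta> 0)"
    "K' = pseudo_link_of oriented n (\<gamma> 1) k (\<delta> 1)"
    and I: "pseudo_link_isotopy thickened_torus_interior n \<gamma> k \<delta>"
    using assms unfolding isotopic_def by blast
  define \<gamma>' where "\<gamma>' t i = torus_to_S3 \<circ> \<gamma> t i" for t i
  define \<delta>' where "\<delta>' t j = torus_to_S3 \<circ> \<delta> t j" for t j
  have I': "pseudo_link_isotopy (S3 - hopf_points) n \<gamma>' k \<delta>'"
    using to_S3.pseudo_link_isotopy_comp[OF I] by (simp add: \<gamma>'_def[abs_def] \<delta>'_def[abs_def])
  then have "pseudo_link_isotopy S3 (n + 2) (\<lambda>t. with_hopf n (\<gamma>' t)) k \<delta>'"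
    by (rule pseudo_link_isotopy_with_hopf)
  moreover have "\<forall>t\<in>{0..1}. pseudo_link_of oriented (n + 2) (with_hopf n (\<gamma>' t)) k (\<delta>' t)
      \<in> hopf_mixed_pseudo_links oriented"
    using I' pseudo_link_of_with_hopf_mem unfolding pseudo_link_isotopy_def by blast
  moreover have "\<exists>i<n + 2. \<exists>i'<n + 2. \<forall>t\<in>{0..1::real}.
      with_hopf n (\<gamma>' t) i = hopf_m \<and> with_hopf n (\<gamma>' t) i' = hopf_l"
    by (rule exI[of _ n], rule conjI, simp, rule exI[of _ "Suc n"]) simp
  moreover have "hopf_union oriented K = pseudo_link_of oriented (n + 2) (with_hopf n (\<gamma>' 0)) k (\<delta>' 0)"
    "hopf_union oriented K' = pseudo_link_of oriented (n + 2) (with_hopf n (\<gamma>' 1)) k (\<delta>' 1)"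
    by (simp_all only: K hopf_union_pseudo_link_of \<gamma>'_def[abs_def] \<delta>'_def[abs_def])
  ultimately show ?thesis
    unfolding hopf_mixed_isotopic_def mem_Collect_eq
    by - (rule exI[of _ "n + 2"], rule exI[of _ "\<lambda>t. with_hopf n (\<gamma>' t)"], rule exI[of _ k],
        rule exI[of _ \<delta>'], simp)
qed

section \<open>Separating the moving part from the fixed Hopf link\<close>

locale hopf_mixed =
  fixes oriented n \<gamma> k \<delta> i\<^sub>m i\<^sub>l
  assumes link: "parametrized_pseudo_link S3 n \<gamma> k \<delta>"
    and mixed: "pseudo_link_of oriented n \<gamma> k \<delta> \<in> hopf_mixed_pseudo_links oriented"
    and m: "i\<^sub>m < n" "closed_curve oriented (\<gamma> i\<^sub>m) = closed_curve oriented hopf_m"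
    and l: "i\<^sub>l < n" "closed_curve oriented (\<gamma> i\<^sub>l) = closed_curve oriented hopf_l"
begin

text \<open>The class of a Hopf component leaves its parametrization open, so it is through point
  sets that the circles are recognized in what follows.\<close>

lemma range_m: "range (\<gamma> i\<^sub>m) = range hopf_m" and range_l: "range (\<gamma> i\<^sub>l) = range hopf_l"
  using closed_curve_eq_range m(2) l(2) by blast+

text \<open>Mixedness forbids discs shared by fixed and moving part, which leaves discs whose
  strands are both fixed. Both strands pass through the centre, and the two Hopf circles are
  disjoint, so such strands lie on one and the same circle. That is excluded by
  \<open>embedded_disc_diameters_not_in_hopf\<close>.\<close>

lemma disc_avoids_hopf:
  assumes j: "j < k"
  shows "\<delta> j ` cball 0 1 \<inter> hopf_points = {}"
proof (rule ccontr)
  assume meets: "\<delta> j ` cball 0 1 \<inter> hopf_points \<noteq> {}"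
  let ?C = "(\<lambda>i. closed_curve oriented (\<gamma> i)) ` {..<n}"
  have "\<forall>D\<in>(\<lambda>j. \<delta> j ` cball 0 1) ` {..<k}.
      \<not> (D \<inter> hopf_points \<noteq> {} \<and> D \<inter> curve_points (?C - hopf_link oriented) \<noteq> {})"
    using mixed
    unfolding hopf_mixed_pseudo_links_def pseudo_link_of_def curve_points_hopf_link by simp
  then have "\<not> (\<delta> j ` cball 0 1 \<inter> hopf_points \<noteq> {} \<and>
      \<delta> j ` cball 0 1 \<inter> curve_points (?C - hopf_link oriented) \<noteq> {})"
    by (rule bspec[where x = "\<delta> j ` cball 0 1"]) (use j in simp)
  with meets have fixed_only: "\<delta> j ` cball 0 1 \<inter> curve_points (?C - hopf_link oriented) = {}"
    by metis
  have "precrossing_disc n \<gamma> (\<delta> j)" using link j by (simp add: parametrized_pseudo_link_def)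
  then obtain i i' p q p' q' where ii: "i < n" "i' < n"
    and im: "\<gamma> i ` {p..q} = \<delta> j ` closed_segment (-1) 1"
      "\<gamma> i' ` {p'..q'} = \<delta> j ` closed_segment (-\<i>) \<i>"
    by (rule precrossing_discE) (rule that)
  have "(0::complex) = (1 / 2) *\<^sub>R (- u) + (1 / 2) *\<^sub>R u" for u by simp
  then have zero: "0 \<in> closed_segment (- u) u" for u :: complex
    unfolding in_segment by (intro exI[of _ "1 / 2"]) auto
  then have centre: "\<delta> j 0 \<in> \<gamma> i ` {p..q}" "\<delta> j 0 \<in> \<gamma> i' ` {p'..q'}"
    using zero[of 1] zero[of \<i>] unfolding im by (simp_all only: imageI)
  then have centre': "\<delta> j 0 \<in> range (\<gamma> i)" "\<delta> j 0 \<in> range (\<gamma> i')"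
    by blast+
  \<comment> \<open>A curve through the centre whose class is not a Hopf class would be moving, and
    the disc was seen to miss all moving curves. The index \<open>a\<close> need not be
    \<open>i\<^sub>m\<close> or \<open>i\<^sub>l\<close> at this stage, so only its class and range
    are identified.\<close>
  have strand: "range (\<gamma> a) = range hopf_m \<or> range (\<gamma> a) = range hopf_l"
    if a: "a < n" and c: "\<delta> j 0 \<in> range (\<gamma> a)" for a
  proof -
    have "closed_curve oriented (\<gamma> a) \<in> hopf_link oriented"
    proof (rule ccontr)
      assume "closed_curve oriented (\<gamma> a) \<notin> hopf_link oriented"
      then have "closed_curve oriented (\<gamma> a) \<in> ?C - hopf_link oriented" using a by blast
      then have "\<delta> j 0 \<in> curve_points (?C - hopf_link oriented)"
        using c closed_curve_self[of "\<gamma> a" oriented] unfolding curve_points_def by blast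
      moreover have "\<delta> j 0 \<in> \<delta> j ` cball 0 1" by simp
      ultimately show False using fixed_only by blast
    qed
    then have "closed_curve oriented (\<gamma> a) = closed_curve oriented hopf_m \<or>
        closed_curve oriented (\<gamma> a) = closed_curve oriented hopf_l"
      by (simp add: hopf_link_def)
    then show ?thesis by (metis closed_curve_eq_range)
  qed
  have "range (\<gamma> i) = range (\<gamma> i')"
    using strand[OF ii(1) centre'(1)] strand[OF ii(2) centre'(2)] centre' range_hopf_disjoint
    by (metis IntI empty_iff)
  moreover have "\<delta> j ` closed_segment (-1) 1 \<subseteq> range (\<gamma> i)"
    "\<delta> j ` closed_segment (-\<i>) \<i> \<subseteq> range (\<gamma> i')"
    unfolding im[symmetric] by auto
  moreover have "range (\<gamma> i) = range hopf_m \<or> range (\<gamma> i) = range hopf_l"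
    using strand[OF ii(1) centre'(1)] .
  moreover have "embedded_disc S3 (\<delta> j)" using link j by (simp add: parametrized_pseudo_link_def)
  ultimately show False using embedded_disc_diameters_not_in_hopf by metis
qed

text \<open>Curves with different numbers can share a point only at the centre of a disc, and discs
  miss the Hopf link. In particular no third number traces a Hopf circle.\<close>

lemma moving_curve_avoids_hopf:
  assumes j: "j < n" "j \<noteq> i\<^sub>m" "j \<noteq> i\<^sub>l"
  shows "range (\<gamma> j) \<inter> hopf_points = {}"
proof -
  have disjoint: "\<gamma> j s \<noteq> \<gamma> i s'" if i: "i < n" "j \<noteq> i" "range (\<gamma> i) \<subseteq> hopf_points" for i s s'
  proof
    assume eq: "\<gamma> j s = \<gamma> i s'"
    then obtain d where d: "d < k" "\<gamma> j s = \<delta> d 0"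
      using link j(1) i(1,2) unfolding parametrized_pseudo_link_def by metis
    have "\<delta> d 0 \<in> hopf_points" using i(3) eq d(2) by (metis rangeI subsetD)
    moreover have "\<delta> d 0 \<in> \<delta> d ` cball 0 1" by simp
    ultimately show False using disc_avoids_hopf[OF d(1)] by blast
  qed
  have "\<gamma> j s \<notin> range (\<gamma> i\<^sub>m)" "\<gamma> j s \<notin> range (\<gamma> i\<^sub>l)" for s
    using disjoint[OF m(1) j(2)] disjoint[OF l(1) j(3)] range_m range_l by blast+
  then show ?thesis unfolding range_m range_l by blast
qed

lemma parametrized_pseudo_link_moving:
  assumes \<sigma>: "bij_betw \<sigma> {..<c} ({..<n} - {i\<^sub>m, i\<^sub>l})"
  shows "parametrized_pseudo_link (S3 - hopf_points) c (\<lambda>i. \<gamma> (\<sigma> i)) k \<delta>"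
proof -
  have \<sigma>n: "\<sigma> a < n" "\<sigma> a \<noteq> i\<^sub>m" "\<sigma> a \<noteq> i\<^sub>l" if "a < c" for a
    using bij_betw_apply[OF \<sigma>, of a] that by auto
  have \<sigma>inj: "\<sigma> a = \<sigma> b \<longleftrightarrow> a = b" if "a < c" "b < c" for a b
    using \<sigma> that by (auto simp: bij_betw_def inj_on_def)
  have \<sigma>surj: "\<exists>a<c. i = \<sigma> a" if "i < n" "i \<noteq> i\<^sub>m" "i \<noteq> i\<^sub>l" for i
    using bij_betw_imp_surj_on[OF \<sigma>] that by (auto simp: image_iff set_eq_iff)
  have reg: "regular_closed_curve (S3 - hopf_points) (\<gamma> (\<sigma> a))" if "a < c" for a
  proof (rule regular_closed_curve_range_subset)
    show "regular_closed_curve S3 (\<gamma> (\<sigma> a))"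
      using link \<sigma>n(1)[OF that] by (simp add: parametrized_pseudo_link_def)
    show "range (\<gamma> (\<sigma> a)) \<subseteq> S3 - hopf_points"
      using moving_curve_avoids_hopf[OF \<sigma>n[OF that]] curve_in[OF link \<sigma>n(1)[OF that]] by blast
  qed
  have disc: "embedded_disc (S3 - hopf_points) (\<delta> j)" if "j < k" for j
  proof (rule embedded_disc_image_subset)
    show "embedded_disc S3 (\<delta> j)" using link that by (simp add: parametrized_pseudo_link_def)
    show "\<delta> j ` cball 0 1 \<subseteq> S3 - hopf_points"
      using disc_avoids_hopf[OF that] disc_subset[OF link that] by blast
  qed
  have pre: "precrossing_disc c (\<lambda>i. \<gamma> (\<sigma> i)) (\<delta> j)" if j: "j < k" for j
  proof -
    have "precrossing_disc n \<gamma> (\<delta> j)" using link j by (simp add: parametrized_pseudo_link_def)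
    then obtain i i' p q p' q' where ii: "i < n" "i' < n" and pq: "p < q" "p' < q'"
      and im: "\<gamma> i ` {p..q} = \<delta> j ` closed_segment (-1) 1"
        "\<gamma> i' ` {p'..q'} = \<delta> j ` closed_segment (-\<i>) \<i>"
      and only: "\<And>b s. b < n \<Longrightarrow> \<gamma> b s \<in> \<delta> j ` cball 0 1 \<Longrightarrow>
        \<exists>a\<in>\<int>. b = i \<and> s + a \<in> {p..q} \<or> b = i' \<and> s + a \<in> {p'..q'}"
      by (rule precrossing_discE) (rule that)
    \<comment> \<open>Both strands have a point in the disc, for instance at the parameters
      \<open>p\<close> and \<open>p'\<close>. Hence they are moving curves and their numbers survive
      the renumbering by \<open>\<sigma>\<close>.\<close>
    have moving: "b \<noteq> i\<^sub>m \<and> b \<noteq> i\<^sub>l" if "\<gamma> b s \<in> \<delta> j ` cball 0 1" for b s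
    proof -
      have "\<gamma> b s \<notin> hopf_points" using that disc_avoids_hopf[OF j] by blast
      then show ?thesis using range_m range_l by blast
    qed
    have "closed_segment (- u) u \<subseteq> cball 0 1" if "norm u \<le> 1" for u :: complex
      using that by (intro closed_segment_subset) auto
    then have seg: "closed_segment (- 1) 1 \<subseteq> cball (0::complex) 1"
      "closed_segment (- \<i>) \<i> \<subseteq> cball 0 1" by auto
    have "\<gamma> i p \<in> \<delta> j ` closed_segment (-1) 1" "\<gamma> i' p' \<in> \<delta> j ` closed_segment (-\<i>) \<i>"
      using pq unfolding im[symmetric] by auto
    then have "\<gamma> i p \<in> \<delta> j ` cball 0 1" "\<gamma> i' p' \<in> \<delta> j ` cball 0 1"
      using seg by blast+
    then obtain a a' where a: "a < c" "i = \<sigma> a" "a' < c" "i' = \<sigma> a'"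
      using \<sigma>surj moving ii by metis
    have only': "\<exists>z\<in>\<int>. b = a \<and> s + z \<in> {p..q} \<or> b = a' \<and> s + z \<in> {p'..q'}"
      if "b < c" "\<gamma> (\<sigma> b) s \<in> \<delta> j ` cball 0 1" for b s
      using only[OF \<sigma>n(1)[OF that(1)] that(2)] \<sigma>inj that(1) a by simp
    show ?thesis
      by (rule precrossing_discI[OF a(1,3) pq _ _ only']) (use a im in simp_all)
  qed
  have simple: "a = b \<and> s - s' \<in> \<int> \<or> (\<exists>j<k. \<gamma> (\<sigma> a) s = \<delta> j 0)"
    if "a < c" "b < c" "\<gamma> (\<sigma> a) s = \<gamma> (\<sigma> b) s'" for a b s s'
    using link \<sigma>n(1)[OF that(1)] \<sigma>n(1)[OF that(2)] that(3) \<sigma>inj[OF that(1,2)]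
    unfolding parametrized_pseudo_link_def by metis
  show ?thesis
    unfolding parametrized_pseudo_link_def
  proof (intro conjI allI impI)
    show "\<delta> j ` cball 0 1 \<inter> \<delta> j' ` cball 0 1 = {}" if "j < k" "j' < k" "j \<noteq> j'" for j j'
      using link that by (simp add: parametrized_pseudo_link_def)
  qed (fact reg disc pre simple)+
qed

text \<open>Deleting two numbers and deleting two classes could differ if a Hopf class occurred
  under a third number. Such a curve would run inside the Hopf link, which the remaining curves
  avoid.\<close>

lemma pseudo_link_of_moving:
  assumes \<sigma>: "bij_betw \<sigma> {..<c} ({..<n} - {i\<^sub>m, i\<^sub>l})"
  shows "pseudo_link_of oriented c (\<lambda>i. \<gamma> (\<sigma> i)) k \<delta> =
    (fst (pseudo_link_of oriented n \<gamma> k \<delta>) - hopf_link oriented, snd (pseudo_link_of oriented n \<gamma> k \<delta>))"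
proof -
  have not_hopf: "closed_curve oriented (\<gamma> j) \<notin> hopf_link oriented"
    if "j < n" "j \<noteq> i\<^sub>m" "j \<noteq> i\<^sub>l" for j
  proof
    assume "closed_curve oriented (\<gamma> j) \<in> hopf_link oriented"
    then have "range (\<gamma> j) \<subseteq> hopf_points"
      using closed_curve_eq_range unfolding hopf_link_def by blast
    then show False using moving_curve_avoids_hopf[OF that] by blast
  qed
  have "(\<lambda>i. closed_curve oriented (\<gamma> (\<sigma> i))) ` {..<c} =
      (\<lambda>i. closed_curve oriented (\<gamma> i)) ` ({..<n} - {i\<^sub>m, i\<^sub>l})"
    using bij_betw_imp_surj_on[OF \<sigma>] by (metis image_image)
  also have "\<dots> = (\<lambda>i. closed_curve oriented (\<gamma> i)) ` {..<n} - hopf_link oriented"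
    using not_hopf m(2) l(2) by (auto simp: hopf_link_def)
  finally show ?thesis by (simp add: pseudo_link_of_def)
qed

end

section \<open>The inverse of adding the Hopf link\<close>

lemma ex_bij_betw_lessThan_Diff: "\<exists>\<sigma> c. bij_betw \<sigma> {..<c::nat} ({..<n::nat} - A)"
  using ex_bij_betw_nat_finite[of "{..<n} - A"] by (auto simp: atLeast0LessThan)

text \<open>The intended inverse of \<open>hopf_union\<close>. The Hopf classes are removed before
  \<open>S3_to_torus\<close> is applied, because that map inverts \<open>torus_to_S3\<close> only
  off the Hopf link.\<close>

definition moving_part ::
  "bool \<Rightarrow> (complex \<times> complex) pseudo_link \<Rightarrow> ((complex \<times> complex) \<times> real) pseudo_link" where
  "moving_part oriented L = map_pseudo_link S3_to_torus (fst L - hopf_link oriented, snd L)"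

lemma hopf_union_in_mixed:
  assumes "K \<in> pseudo_links oriented thickened_torus_interior"
  shows "hopf_union oriented K \<in> hopf_mixed_pseudo_links oriented"
    and "moving_part oriented (hopf_union oriented K) = K"
proof -
  obtain n \<gamma> k \<delta> where K: "K = pseudo_link_of oriented n \<gamma> k \<delta>"
    and L: "parametrized_pseudo_link thickened_torus_interior n \<gamma> k \<delta>"
    using assms unfolding pseudo_links_def by blast
  define \<gamma>' where "\<gamma>' i = torus_to_S3 \<circ> \<gamma> i" for i
  define \<delta>' where "\<delta>' j = torus_to_S3 \<circ> \<delta> j" for j
  have L': "parametrized_pseudo_link (S3 - hopf_points) n \<gamma>' k \<delta>'"
    using to_S3.parametrized_pseudo_link_comp[OF L] by (simp add: \<gamma>'_def[abs_def] \<delta>'_def[abs_def])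
  have U: "hopf_union oriented K = pseudo_link_of oriented (n + 2) (with_hopf n \<gamma>') k \<delta>'"
    by (simp only: K hopf_union_pseudo_link_of \<gamma>'_def[abs_def] \<delta>'_def[abs_def])
  show mem: "hopf_union oriented K \<in> hopf_mixed_pseudo_links oriented"
    unfolding U using L' by (rule pseudo_link_of_with_hopf_mem)
  \<comment> \<open>The union is itself a mixed pseudo link with its circles at the last two
    numbers, so the identity can serve as the renumbering.\<close>
  interpret hopf_mixed oriented "n + 2" "with_hopf n \<gamma>'" k \<delta>' n "Suc n"
    by unfold_locales (use parametrized_pseudo_link_with_hopf[OF L'] mem in \<open>simp_all add: U\<close>)
  have "{..<n + 2} - {n, Suc n} = {..<n}" by auto
  then have "bij_betw (\<lambda>i. i) {..<n} ({..<n + 2} - {n, Suc n})" by (simp add: bij_betw_def)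
  from pseudo_link_of_moving[OF this]
  have "moving_part oriented (hopf_union oriented K) =
      map_pseudo_link S3_to_torus (pseudo_link_of oriented n (with_hopf n \<gamma>') k \<delta>')"
    by (simp only: moving_part_def U)
  also have "\<dots> = pseudo_link_of oriented n (\<lambda>i. S3_to_torus \<circ> with_hopf n \<gamma>' i) k (\<lambda>j. S3_to_torus \<circ> \<delta>' j)"
    by (rule map_pseudo_link_of)
  also have "\<dots> = K"
  proof -
    have "S3_to_torus \<circ> with_hopf n \<gamma>' i = \<gamma> i" if "i < n" for i
      using that to_S3.left_inverse[OF curve_in[OF L that]] by (auto simp: \<gamma>'_def)
    \<comment> \<open>Disc maps are total functions whose values off the closed unit disc are
      arbitrary. What is recovered is the image of that disc, and this is all that enters the pseudo
      link.\<close>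
    moreover have "(S3_to_torus \<circ> \<delta>' j) ` cball 0 1 = \<delta> j ` cball 0 1" if "j < k" for j
    proof (rule image_cong[OF refl])
      fix z :: complex assume "z \<in> cball 0 1"
      then have "\<delta> j z \<in> thickened_torus_interior" using disc_subset[OF L that] by blast
      then show "(S3_to_torus \<circ> \<delta>' j) z = \<delta> j z" by (simp add: \<delta>'_def to_S3.left_inverse)
    qed
    ultimately show ?thesis by (simp add: K pseudo_link_of_def)
  qed
  finally show "moving_part oriented (hopf_union oriented K) = K" .
qed

lemma moving_part_in_torus:
  assumes "L \<in> hopf_mixed_pseudo_links oriented"
  shows "moving_part oriented L \<in> pseudo_links oriented thickened_torus_interior"
    and "hopf_union oriented (moving_part oriented L) = L"
proof -
  have "L \<in> pseudo_links oriented S3" and sub: "hopf_link oriented \<subseteq> fst L"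
    using assms unfolding hopf_mixed_pseudo_links_def by auto
  then obtain n \<gamma> k \<delta> where L: "L = pseudo_link_of oriented n \<gamma> k \<delta>"
    and P: "parametrized_pseudo_link S3 n \<gamma> k \<delta>"
    unfolding pseudo_links_def by blast
  obtain i i' where "i < n" "closed_curve oriented (\<gamma> i) = closed_curve oriented hopf_m"
    "i' < n" "closed_curve oriented (\<gamma> i') = closed_curve oriented hopf_l"
    using sub unfolding L pseudo_link_of_def hopf_link_def by auto
  then interpret hopf_mixed oriented n \<gamma> k \<delta> i i'
    using P assms by unfold_locales (simp_all add: L)
  obtain \<sigma> and c :: nat where \<sigma>: "bij_betw \<sigma> {..<c} ({..<n} - {i, i'})"
    using ex_bij_betw_lessThan_Diff[of n "{i, i'}"] by blast
  note Q = parametrized_pseudo_link_moving[OF \<sigma>]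
  have M: "moving_part oriented L =
      pseudo_link_of oriented c (\<lambda>i. S3_to_torus \<circ> \<gamma> (\<sigma> i)) k (\<lambda>j. S3_to_torus \<circ> \<delta> j)"
    unfolding moving_part_def L pseudo_link_of_moving[OF \<sigma>, symmetric] by (rule map_pseudo_link_of)
  show "moving_part oriented L \<in> pseudo_links oriented thickened_torus_interior"
    unfolding M by (rule pseudo_link_of_mem_pseudo_links[OF to_torus.parametrized_pseudo_link_comp[OF Q]])
  have "map_pseudo_link torus_to_S3 (moving_part oriented L) =
      pseudo_link_of oriented c (\<lambda>i. \<gamma> (\<sigma> i)) k \<delta>"
  proof -
    have "torus_to_S3 \<circ> (S3_to_torus \<circ> \<gamma> (\<sigma> a)) = \<gamma> (\<sigma> a)" if "a < c" for a
      using to_torus.left_inverse[OF curve_in[OF Q that]] by auto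
    moreover have "(torus_to_S3 \<circ> (S3_to_torus \<circ> \<delta> j)) ` cball 0 1 = \<delta> j ` cball 0 1" if "j < k" for j
    proof (rule image_cong[OF refl])
      fix z :: complex assume "z \<in> cball 0 1"
      then have "\<delta> j z \<in> S3 - hopf_points" using disc_subset[OF Q that] by blast
      then show "(torus_to_S3 \<circ> (S3_to_torus \<circ> \<delta> j)) z = \<delta> j z"
        by (simp add: to_torus.left_inverse)
    qed
    ultimately show ?thesis unfolding M map_pseudo_link_of by (simp add: pseudo_link_of_def)
  qed
  \<comment> \<open>By \<open>sub\<close> the removed classes were all present, so adding the Hopf
    link restores exactly \<open>fst L\<close>.\<close>
  then show "hopf_union oriented (moving_part oriented L) = L"
    using sub by (auto simp: hopf_union_def pseudo_link_of_moving[OF \<sigma>] L prod_eq_iff)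
qed

text \<open>The Hopf circles occupy the same two numbers \<open>i\<close> and \<open>i'\<close> at
  all times. So a single renumbering \<open>\<sigma>\<close>, chosen independently of
  \<open>t\<close>, describes the moving part throughout, and the continuity of the moving family is
  inherited from the given isotopy.\<close>

lemma moving_part_isotopic:
  assumes "(L, L') \<in> hopf_mixed_isotopic oriented"
  shows "(moving_part oriented L, moving_part oriented L') \<in> isotopic oriented thickened_torus_interior"
proof -
  obtain n \<gamma> k \<delta> i i' where L: "L = pseudo_link_of oriented n (\<gamma> 0) k (\<delta> 0)"
    "L' = pseudo_link_of oriented n (\<gamma> 1) k (\<delta> 1)"
    and I: "pseudo_link_isotopy S3 n \<gamma> k \<delta>"
    and mix: "\<And>t. t \<in> {0..1} \<Longrightarrow>
      pseudo_link_of oriented n (\<gamma> t) k (\<delta> t) \<in> hopf_mixed_pseudo_links oriented"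
    and ii: "i < n" "i' < n" "\<And>t. t \<in> {0..1} \<Longrightarrow> \<gamma> t i = hopf_m \<and> \<gamma> t i' = hopf_l"
    using assms unfolding hopf_mixed_isotopic_def by blast
  have H: "hopf_mixed oriented n (\<gamma> t) k (\<delta> t) i i'" if "t \<in> {0..1}" for t
    using I mix[OF that] ii(1,2) ii(3)[OF that] that
    by unfold_locales (simp_all add: pseudo_link_isotopy_def)
  obtain \<sigma> and c :: nat where \<sigma>: "bij_betw \<sigma> {..<c} ({..<n} - {i, i'})"
    using ex_bij_betw_lessThan_Diff[of n "{i, i'}"] by blast
  have "\<sigma> a < n" if "a < c" for a using bij_betw_apply[OF \<sigma>, of a] that by auto
  then have "pseudo_link_isotopy (S3 - hopf_points) c (\<lambda>t a. \<gamma> t (\<sigma> a)) k \<delta>"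
    using I hopf_mixed.parametrized_pseudo_link_moving[OF H \<sigma>]
    by (simp add: pseudo_link_isotopy_def)
  then have I': "pseudo_link_isotopy thickened_torus_interior c
      (\<lambda>t a. S3_to_torus \<circ> \<gamma> t (\<sigma> a)) k (\<lambda>t j. S3_to_torus \<circ> \<delta> t j)"
    by (rule to_torus.pseudo_link_isotopy_comp)
  have M: "moving_part oriented (pseudo_link_of oriented n (\<gamma> t) k (\<delta> t)) =
      pseudo_link_of oriented c (\<lambda>a. S3_to_torus \<circ> \<gamma> t (\<sigma> a)) k (\<lambda>j. S3_to_torus \<circ> \<delta> t j)"
    if "t \<in> {0..1}" for t
    unfolding moving_part_def hopf_mixed.pseudo_link_of_moving[OF H[OF that] \<sigma>, symmetric]
    by (rule map_pseudo_link_of)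
  show ?thesis
    unfolding isotopic_def L mem_Collect_eq
    by (rule exI[of _ c], rule exI[of _ "\<lambda>t a. S3_to_torus \<circ> \<gamma> t (\<sigma> a)"], rule exI[of _ k],
        rule exI[of _ "\<lambda>t j. S3_to_torus \<circ> \<delta> t j"]) (simp add: M I')
qed

section \<open>The bijection of isotopy classes\<close>

lemma isotopic_subset: "isotopic oriented X \<subseteq> pseudo_links oriented X \<times> pseudo_links oriented X"
proof -
  have "x \<in> pseudo_links oriented X \<times> pseudo_links oriented X" if x: "x \<in> isotopic oriented X" for x
  proof -
    obtain n \<gamma> k \<delta> where
      "x = (pseudo_link_of oriented n (\<gamma> 0) k (\<delta> 0), pseudo_link_of oriented n (\<gamma> 1) k (\<delta> 1))"
      "pseudo_link_isotopy X n \<gamma> k \<delta>"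
      using x unfolding isotopic_def by blast
    then show ?thesis
      by (simp add: pseudo_link_isotopy_def pseudo_link_of_mem_pseudo_links)
  qed
  then show ?thesis ..
qed

lemma hopf_mixed_isotopic_subset:
  "hopf_mixed_isotopic oriented \<subseteq> hopf_mixed_pseudo_links oriented \<times> hopf_mixed_pseudo_links oriented"
proof -
  have "x \<in> hopf_mixed_pseudo_links oriented \<times> hopf_mixed_pseudo_links oriented"
    if x: "x \<in> hopf_mixed_isotopic oriented" for x
  proof -
    obtain n \<gamma> k \<delta> where
      "x = (pseudo_link_of oriented n (\<gamma> 0) k (\<delta> 0), pseudo_link_of oriented n (\<gamma> 1) k (\<delta> 1))"
      "\<forall>t\<in>{0..1::real}. pseudo_link_of oriented n (\<gamma> t) k (\<delta> t) \<in> hopf_mixed_pseudo_links oriented"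
      using x unfolding hopf_mixed_isotopic_def by blast
    then show ?thesis by simp
  qed
  then show ?thesis ..
qed

text \<open>A class is the relation image of a point. The bound on \<open>s\<close> makes every
  member of a class in \<open>B\<close> a value of \<open>f\<close>, so \<open>f\<close> maps
  classes onto classes. The bound on \<open>r\<close> keeps classes inside \<open>A\<close>, where
  injectivity of \<open>f\<close> on points gives injectivity on subsets.\<close>

lemma bij_betw_quotient_image:
  assumes f: "bij_betw f A B" and r: "r \<subseteq> A \<times> A" and s: "s \<subseteq> B \<times> B"
    and rs: "\<And>x y. x \<in> A \<Longrightarrow> y \<in> A \<Longrightarrow> (x, y) \<in> r \<longleftrightarrow> (f x, f y) \<in> s"
  shows "x \<in> A \<Longrightarrow> f ` (r `` {x}) = s `` {f x}" and "bij_betw ((`) f) (A // r) (B // s)"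
proof -
  have fA: "f ` A = B" and inj: "inj_on f A" using f by (auto simp: bij_betw_def)
  show cls: "f ` (r `` {x}) = s `` {f x}" if x: "x \<in> A" for x
  proof (intro equalityI subsetI)
    fix b assume "b \<in> f ` (r `` {x})"
    then show "b \<in> s `` {f x}" using rs[OF x] r by auto
  next
    fix b assume b: "b \<in> s `` {f x}"
    then obtain y where "y \<in> A" "b = f y" using s fA by blast
    then show "b \<in> f ` (r `` {x})" using rs[OF x] b by auto
  qed
  have "\<Union> (A // r) \<subseteq> A" using r by (auto simp: quotient_def)
  then have "inj_on ((`) f) (A // r)"
    using inj by (intro inj_on_image) (rule inj_on_subset)
  moreover have "(`) f ` (A // r) = B // s"
    unfolding quotient_def fA[symmetric] using cls by auto
  ultimately show "bij_betw ((`) f) (A // r) (B // s)" by (simp add: bij_betw_def)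
qed

theorem theorem3p8:
  fixes oriented :: bool
  shows "\<exists>\<Phi>. bij_betw \<Phi>
             (pseudo_links oriented thickened_torus_interior //
                isotopic oriented thickened_torus_interior)
             (hopf_mixed_pseudo_links oriented // hopf_mixed_isotopic oriented) \<and>
           (\<forall>K \<in> pseudo_links oriented thickened_torus_interior.
              \<Phi> (isotopic oriented thickened_torus_interior `` {K}) =
                hopf_mixed_isotopic oriented `` {hopf_union oriented K})"
proof -
  let ?A = "pseudo_links oriented thickened_torus_interior"
  have bij: "bij_betw (hopf_union oriented) ?A (hopf_mixed_pseudo_links oriented)"
    by (rule bij_betw_byWitness[where f' = "moving_part oriented"])
      (auto simp: hopf_union_in_mixed moving_part_in_torus)
  \<comment> \<open>For the converse, \<open>moving_part_isotopic\<close> carries an isotopy of the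
    unions back to the torus side, where \<open>moving_part\<close> undoes \<open>hopf_union\<close>
    at both ends.\<close>
  have iff: "(K, K') \<in> isotopic oriented thickened_torus_interior \<longleftrightarrow>
      (hopf_union oriented K, hopf_union oriented K') \<in> hopf_mixed_isotopic oriented"
    if "K \<in> ?A" "K' \<in> ?A" for K K'
    using hopf_union_isotopic moving_part_isotopic hopf_union_in_mixed(2)[OF that(1)]
      hopf_union_in_mixed(2)[OF that(2)] by metis
  note quot = bij_betw_quotient_image[OF bij isotopic_subset hopf_mixed_isotopic_subset iff]
  show ?thesis
    by (intro exI[of _ "(`) (hopf_union oriented)"] conjI ballI) (rule quot; assumption)+
qed

end
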